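(* For $n\ge1$ let $\mathbb{M}_n$ be a uniform random labeled map with $n$ edges (genus unconstrained), and let $\#\mathsf{F}(\mathbb{M}_n)$, $\#\mathsf{V}(\mathbb{M}_n)$ and $\mathsf{Genus}(\mathbb{M}_n)$ be respectively its number of faces, its number of vertices and its genus. Then $$\left(\frac{\#\mathsf{V}(\mathbb{M}_n)-\log n}{\sqrt{\log n}},\ \frac{\#\mathsf{F}(\mathbb{M}_n)-\log n}{\sqrt{\log n}},\ \frac{\mathsf{Genus}(\mathbb{M}_n)-\frac n2+\log n}{\sqrt{\log n}}\right)\xrightarrow[n\to\infty]{(d)}\left(\mathcal{N}_1,\ \mathcal{N}_2,\ -\frac{\mathcal{N}_1+\mathcal{N}_2}{2}\right),$$ where $\mathcal{N}_1$ and $\mathcal{N}_2$ are independent standard Gaussian random variables.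
   Context: A labeled map with $n$ edges (connected, on an oriented surface) is identified with a pair $(\alpha,\phi)$ of permutations of $\{1,\dots,2n\}$ such that $\alpha$ is an involution without fixed points and the subgroup generated by $\alpha$ and $\phi$ acts transitively on $\{1,\dots,2n\}$. Its edges are the cycles of $\alpha$, its faces are the cycles of $\phi$, its vertices are the cycles of $\phi\circ\alpha$, and its genus is given by Euler's relation $\#\mathsf{V}+\#\mathsf{F}-n=2(1-\mathsf{Genus})$. $\mathbb{M}_n$ is uniform over the finite set of all such pairs. *)

theory Defs
  imports
    "HOL-Probability.Probability"
    "HOL-Algebra.Sym_Groups"
    "HOL-Combinatorics.Orbits"
begin

section \<open>Labeled maps\<close>

text \<open>
  A labeled map with \<open>n\<close> edges is a pair \<open>(\<alpha>, \<phi>)\<close> of permutations of \<open>{1..2*n}\<close>.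
  Permutations are total functions on \<^typ>\<open>nat\<close> that are the identity outside \<open>{1..2*n}\<close>,
  so distinct pairs of functions are distinct maps.
\<close>

type_synonym labeled_map = "(nat \<Rightarrow> nat) \<times> (nat \<Rightarrow> nat)"

definition labeled_maps :: "nat \<Rightarrow> labeled_map set" where
  "labeled_maps n = {(\<alpha>, \<phi>).
     \<alpha> permutes {1..2*n} \<and> \<phi> permutes {1..2*n} \<and>
     \<alpha> \<circ> \<alpha> = id \<and> (\<forall>x\<in>{1..2*n}. \<alpha> x \<noteq> x) \<and>
     (\<forall>x\<in>{1..2*n}. \<forall>y\<in>{1..2*n}. \<exists>g\<in>generate (sym_group (2*n)) {\<alpha>, \<phi>}. g x = y)}"

text \<open>Fixed points in \<open>S\<close> count as cycles of length one.\<close>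

definition cycles_on :: "'a set \<Rightarrow> ('a \<Rightarrow> 'a) \<Rightarrow> 'a set set" where
  "cycles_on S p = orbit p ` S"

definition faces :: "nat \<Rightarrow> labeled_map \<Rightarrow> nat set set" where
  "faces n = (\<lambda>(\<alpha>, \<phi>). cycles_on {1..2*n} \<phi>)"

definition vertices :: "nat \<Rightarrow> labeled_map \<Rightarrow> nat set set" where
  "vertices n = (\<lambda>(\<alpha>, \<phi>). cycles_on {1..2*n} (\<phi> \<circ> \<alpha>))"

text \<open>
  The genus is the solution of Euler's relation; being real-valued, it needs no
  integrality or nonnegativity argument to be well defined.
\<close>

definition genus :: "nat \<Rightarrow> labeled_map \<Rightarrow> real" where
  "genus n m = 1 - (real (card (vertices n m)) + real (card (faces n m)) - real n) / 2"

lemma euler_relation: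
  "real (card (vertices n m)) + real (card (faces n m)) - real n = 2 * (1 - genus n m)"
  by (simp add: genus_def)

definition uniform_map :: "nat \<Rightarrow> labeled_map pmf" where
  "uniform_map n = pmf_of_set (labeled_maps n)"

lemma finite_labeled_maps: "finite (labeled_maps n)"
proof (rule finite_subset)
  show "labeled_maps n \<subseteq> {p. p permutes {1..2*n}} \<times> {p. p permutes {1..2*n}}"
    by (auto simp: labeled_maps_def)
qed (simp add: finite_permutations)

lemma labeled_maps_nonempty: "labeled_maps n \<noteq> {}"
proof -
  define \<alpha> :: "nat \<Rightarrow> nat" where
    "\<alpha> x = (if x \<in> {1..2*n} then if odd x then x + 1 else x - 1 else x)" for x
  define \<phi> :: "nat \<Rightarrow> nat" where
    "\<phi> x = (if x \<in> {1..2*n} then if x = 2*n then 1 else x + 1 else x)" for x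
  define \<psi> :: "nat \<Rightarrow> nat" where
    "\<psi> x = (if x \<in> {1..2*n} then if x = 1 then 2*n else x - 1 else x)" for x
  have \<alpha>\<alpha>: "\<alpha> (\<alpha> x) = x" for x
    unfolding \<alpha>_def by (auto; presburger)
  have "bij_betw \<alpha> {1..2*n} {1..2*n}"
    by (rule bij_betw_byWitness[where f' = \<alpha>]) (auto simp: \<alpha>\<alpha>, auto simp: \<alpha>_def, presburger+)
  then have \<alpha>: "\<alpha> permutes {1..2*n}"
    by (rule bij_imp_permutes) (auto simp: \<alpha>_def)
  have "bij_betw \<phi> {1..2*n} {1..2*n}"
    by (rule bij_betw_byWitness[where f' = \<psi>]) (auto simp: \<phi>_def \<psi>_def split: if_splits)
  then have \<phi>: "\<phi> permutes {1..2*n}"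
    by (rule bij_imp_permutes) (auto simp: \<phi>_def)
  let ?H = "generate (sym_group (2*n)) {\<alpha>, \<phi>}"
  have comp: "g \<circ> h \<in> ?H" if "g \<in> ?H" "h \<in> ?H" for g h
    using generate.eng[OF that] by (simp add: sym_group_mult)
  have \<phi>H: "\<phi> \<in> ?H"
    by (simp add: generate.incl)
  have pow: "\<phi> ^^ k \<in> ?H" for k
  proof (induction k)
    case 0
    show ?case using generate.one[of "sym_group (2*n)"] by (simp add: sym_group_one id_def)
  qed (use comp[OF \<phi>H] in \<open>simp add: comp_def\<close>)
  have shift: "(\<phi> ^^ k) x = x + k" if "1 \<le> x" "x + k \<le> 2*n" for x k
    using that by (induction k) (auto simp: \<phi>_def)
  have "\<exists>g\<in>?H. g x = y" if "x \<in> {1..2*n}" "y \<in> {1..2*n}" for x y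
  proof -
    define g where "g = (\<phi> ^^ (y - 1)) \<circ> (\<phi> \<circ> (\<phi> ^^ (2*n - x)))"
    have "g \<in> ?H"
      unfolding g_def by (intro comp pow \<phi>H)
    moreover have "g x = y"
      using that shift[of x "2*n - x"] shift[of 1 "y - 1"] by (simp add: g_def \<phi>_def)
    ultimately show ?thesis by blast
  qed
  moreover have "\<alpha> x \<noteq> x" if "x \<in> {1..2*n}" for x
    using that by (auto simp: \<alpha>_def)
  ultimately have "(\<alpha>, \<phi>) \<in> labeled_maps n"
    using \<alpha> \<phi> \<alpha>\<alpha> by (auto simp: labeled_maps_def fun_eq_iff)
  then show ?thesis by blast
qed


section \<open>Convergence in distribution\<close>

text \<open>
  \<^const>\<open>weak_conv_m\<close> only covers measures on the real line, via distribution functions.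
\<close>

definition weak_conv_borel ::
    "(nat \<Rightarrow> 'a::topological_space measure) \<Rightarrow> 'a measure \<Rightarrow> bool" where
  "weak_conv_borel \<mu> M \<longleftrightarrow>
     (\<forall>f :: 'a \<Rightarrow> real. continuous_on UNIV f \<and> bounded (range f) \<longrightarrow>
        (\<lambda>n. integral\<^sup>L (\<mu> n) f) \<longlonglongrightarrow> integral\<^sup>L M f)"

lemma weak_conv_borel_iff_weak_conv_m:
  assumes "\<And>n. real_distribution (\<mu> n)" and "real_distribution M"
  shows "weak_conv_borel \<mu> M \<longleftrightarrow> weak_conv_m \<mu> M"
proof
  assume *: "weak_conv_borel \<mu> M"
  show "weak_conv_m \<mu> M"
  proof (rule integral_bdd_continuous_conv_imp_weak_conv[OF assms])
    fix f :: "real \<Rightarrow> real"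
    assume "\<And>x. isCont f x" and "\<And>x. \<bar>f x\<bar> \<le> 1"
    then have "continuous_on UNIV f" "bounded (range f)"
      by (auto simp: continuous_on_eq_continuous_at bounded_iff)
    with * show "(\<lambda>n. integral\<^sup>L (\<mu> n) f) \<longlonglongrightarrow> integral\<^sup>L M f"
      by (simp add: weak_conv_borel_def)
  qed
next
  assume *: "weak_conv_m \<mu> M"
  show "weak_conv_borel \<mu> M"
    unfolding weak_conv_borel_def
  proof (intro allI impI, elim conjE)
    fix f :: "real \<Rightarrow> real"
    assume "continuous_on UNIV f" and "bounded (range f)"
    then obtain B where "\<And>x. isCont f x" "\<And>x. norm (f x) \<le> B"
      by (auto simp: continuous_on_eq_continuous_at bounded_iff)
    then show "(\<lambda>n. integral\<^sup>L (\<mu> n) f) \<longlonglongrightarrow> integral\<^sup>L M f"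
      by (rule weak_conv_imp_integral_bdd_continuous_conv[OF assms *])
  qed
qed

definition conv_in_distr ::
    "(nat \<Rightarrow> 'a measure) \<Rightarrow> (nat \<Rightarrow> 'a \<Rightarrow> 'c::topological_space) \<Rightarrow>
     'b measure \<Rightarrow> ('b \<Rightarrow> 'c) \<Rightarrow> bool" where
  "conv_in_distr M X P Y \<longleftrightarrow>
     weak_conv_borel (\<lambda>n. distr (M n) borel (X n)) (distr P borel Y)"

end

theory Submission
  imports Defs
begin

hide_const (open) Finite_Cartesian_Product.transpose

text \<open>
  Fix the matching \<open>\<alpha>\<close> and reveal a uniform permutation \<open>\<phi>\<close> one value at a time. When \<open>k\<close> values
  remain, exactly one of them closes a cycle of \<open>\<phi>\<close> and exactly one closes a cycle of \<open>\<phi> \<circ> \<alpha>\<close>. If the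
  next argument is chosen so that these two values differ, which is possible unless a certain
  permutation of the \<open>k\<close> remaining points is the identity, the two indicators are those of disjoint
  events of probability \<open>1/k\<close>. Hence the joint generating function of the numbers of faces and vertices
  is close to the product of the \<open>1 + (a - 1)/k + (b - 1)/k\<close>, and at \<open>a, b = exp (i O(1/sqrt (ln n)))\<close>
  this product behaves like that of two independent Gaussians. A union bound over the sets invariant
  under \<open>\<alpha>\<close> shows that dropping transitivity costs \<open>O(1/n)\<close>. Convergence of the joint characteristic
  function gives joint convergence in law by applying the one-dimensional continuity theorem twice to
  reweighted measures, and the genus is an affine function of the other two coordinates.
\<close>

section \<open>Revealing a permutation\<close>

text \<open>A crude comparison fails by exactly one logarithm. For
  \<open>a, b = exp (i O(1/sqrt (ln n)))\<close> a step at which the two closing events coincide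
  costs \<open>|a - 1| |b - 1| / k\<close>; summed over all \<open>k\<close> this is of order 1, as
  it has to be, since it would describe two equal counts. The task is therefore to bound, uniformly
  in \<open>n\<close>, the expected sum of \<open>1/k\<close> over the coinciding steps. They are
  rare because a revealed value destroys each fixed point with probability \<open>1/k\<close>, while
  it creates only \<open>2/k\<close> new ones on average. The slope \<open>harm k / k\<close> of the
  potential is dictated by the coinciding steps: when all \<open>k\<close> points are fixed the
  linear part equals \<open>harm k\<close>, which falls by \<open>1/k\<close> on passing to
  \<open>k - 1\<close>. The step \<open>k = 1\<close> always coincides; it is kept out of the
  product and paid for by \<open>|a b - 1|\<close>, which is small only because \<open>a\<close> and
  \<open>b\<close> are close to 1. On the analytic side the one-dimensional continuity theorem
  concerns probability laws, so a test function of one coordinate can serve as a density for the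
  other only after a shift that makes it positive.\<close>

lemma contract_permutes:
  assumes "\<phi> permutes R" "u \<in> R" "\<phi> u = y"
  shows "\<phi> \<circ> transpose u y permutes R - {y}"
proof (rule permutes_superset)
  have "y \<in> R" using assms by (auto simp: permutes_in_image)
  then show "\<phi> \<circ> transpose u y permutes R"
    using assms by (intro permutes_compose permutes_swap_id)
qed (use assms in auto)

text \<open>The contraction lets \<open>u\<close> jump over \<open>y\<close>, which shortens the
  cycle through \<open>y\<close> by one point. A cycle is lost only if \<open>y\<close> was alone in
  it, and then \<open>y = u\<close>.\<close>

lemma card_cycles_contract:
  assumes \<phi>: "\<phi> permutes R" and R: "finite R" and u: "u \<in> R" and y: "\<phi> u = y"
  shows "card (cycles_on R \<phi>) =
    card (cycles_on (R - {y}) (\<phi> \<circ> transpose u y)) + (if y = u then 1 else 0)"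
proof -
  have yR: "y \<in> R" using \<phi> u y by (auto simp: permutes_in_image)
  have perm: "permutation \<phi>" using \<phi> R by (auto simp: permutation_permutes)
  have self: "x \<in> orbit \<phi> x" for x by (rule permutation_self_in_orbit[OF perm])
  show ?thesis
  proof (cases "y = u")
    case True
    have orb: "orbit \<phi> y = {y}" using y True by (simp add: orbit_eq_singleton_iff)
    have "cycles_on R \<phi> = insert {y} (cycles_on (R - {y}) \<phi>)"
    proof -
      have "orbit \<phi> ` insert y (R - {y}) = insert {y} (orbit \<phi> ` (R - {y}))"
        by (simp only: image_insert orb)
      then show ?thesis using yR by (simp only: cycles_on_def insert_Diff)
    qed
    moreover have "{y} \<notin> cycles_on (R - {y}) \<phi>"
      using self by (auto simp: cycles_on_def)
    moreover have "finite (cycles_on (R - {y}) \<phi>)"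
      using R by (simp add: cycles_on_def)
    ultimately show ?thesis using True by simp
  next
    case False
    define \<phi>' where "\<phi>' = \<phi> \<circ> transpose u y"
    have \<phi>': "\<phi>' permutes R - {y}" unfolding \<phi>'_def by (rule contract_permutes[OF \<phi> u y])
    have perm': "permutation \<phi>'" using \<phi>' R by (auto simp: permutation_permutes)
    have self': "x \<in> orbit \<phi>' x" for x by (rule permutation_self_in_orbit[OF perm'])
    have inj: "\<phi> v = \<phi> w \<longleftrightarrow> v = w" for v w
      using \<phi> by (meson permutes_inj injD)
    have \<phi>'u: "\<phi>' u = \<phi> y" and \<phi>'o: "\<And>z. z \<noteq> u \<Longrightarrow> z \<noteq> y \<Longrightarrow> \<phi>' z = \<phi> z"
      by (auto simp: \<phi>'_def transpose_def)
    have \<phi>'_ne: "\<phi>' z = y \<longleftrightarrow> z = y" for z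
    proof -
      have "\<phi>' y = y" using \<phi>' by (auto simp: permutes_def)
      then show ?thesis using permutes_inj[OF \<phi>'] by (metis injD)
    qed
    have orb: "orbit \<phi>' x = orbit \<phi> x - {y}" if x: "x \<noteq> y" for x
    proof (intro equalityI subsetI)
      fix t assume "t \<in> orbit \<phi>' x"
      then show "t \<in> orbit \<phi> x - {y}"
      proof induction
        case base
        show ?case
        proof (cases "x = u")
          case True
          have "\<phi> (\<phi> x) \<in> orbit \<phi> x" by (intro orbit.intros)
          then show ?thesis using True \<phi>'u y x \<phi>'_ne[of x] by simp
        next
          case False
          then show ?thesis using \<phi>'o[of x] x \<phi>'_ne[of x] orbit.base[of \<phi> x] by simp
        qed
      next
        case (step t)
        show ?case
        proof (cases "t = u")
          case True
          have "\<phi> (\<phi> t) \<in> orbit \<phi> x" using step.IH by (intro orbit.step) auto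
          then show ?thesis using True \<phi>'u y step.IH \<phi>'_ne[of t] by simp
        next
          case False
          then show ?thesis
            using \<phi>'o[of t] step.IH \<phi>'_ne[of t] orbit.step[of t \<phi> x] by simp
        qed
      qed
    next
      fix t assume "t \<in> orbit \<phi> x - {y}"
      then have "t \<in> orbit \<phi> x" "t \<noteq> y" by auto
      \<comment> \<open>While the original orbit stands at \<open>y\<close>, the contracted one
        still waits at \<open>u\<close>, the only predecessor of \<open>y\<close>; the induction
        carries this alternative along.\<close>
      have "(t \<noteq> y \<longrightarrow> t \<in> orbit \<phi>' x) \<and> (t = y \<longrightarrow> u \<in> orbit \<phi>' x)"
        using \<open>t \<in> orbit \<phi> x\<close>
      proof induction
        case base
        show ?case
        proof (cases "x = u")
          case True
          then show ?thesis using y self'[of u] by simp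
        next
          case False
          then have "\<phi> x \<noteq> y" using inj y by metis
          then show ?thesis using \<phi>'o[OF False x] orbit.base[of \<phi>' x] by simp
        qed
      next
        case (step t)
        consider "t = y" | "t = u" | "t \<noteq> y" "t \<noteq> u" by blast
        then show ?case
        proof cases
          case 1
          then have "\<phi> t \<noteq> y" using inj[of t u] y \<open>y \<noteq> u\<close> by simp
          then show ?thesis using 1 step.IH \<phi>'u orbit.step[of u \<phi>' x] by simp
        next
          case 2
          then show ?thesis using step.IH y \<open>y \<noteq> u\<close> by auto
        next
          case 3
          then have "\<phi> t \<noteq> y" using inj[of t u] y by simp
          then show ?thesis using 3 step.IH \<phi>'o[of t] orbit.step[of t \<phi>' x] by simp
        qed
      qed
      with \<open>t \<noteq> y\<close> show "t \<in> orbit \<phi>' x" by blast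
    qed
    have cyc: "cycles_on R \<phi> = orbit \<phi> ` (R - {y})"
    proof -
      have "orbit \<phi> y = orbit \<phi> u"
        using permutation_orbit_step[OF perm, of u] y by simp
      moreover have "cycles_on R \<phi> = insert (orbit \<phi> y) (orbit \<phi> ` (R - {y}))"
        using yR by (auto simp: cycles_on_def)
      moreover have "orbit \<phi> u \<in> orbit \<phi> ` (R - {y})" using u False by simp
      ultimately show ?thesis by (simp add: insert_absorb)
    qed
    \<comment> \<open>Each of these orbits contains a point other than \<open>y\<close>, and that
      point identifies it.\<close>
    have "inj_on (\<lambda>A. A - {y}) (orbit \<phi> ` (R - {y}))"
    proof (rule inj_onI)
      fix A B assume "A \<in> orbit \<phi> ` (R - {y})" "B \<in> orbit \<phi> ` (R - {y})" "A - {y} = B - {y}"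
      then obtain x x' where *: "A = orbit \<phi> x" "B = orbit \<phi> x'" "x \<noteq> y" "x' \<noteq> y" by blast
      then have "x \<in> orbit \<phi> x'" using self[of x] \<open>A - {y} = B - {y}\<close> by blast
      then show "A = B"
        using orbit_cyclic_eq3[OF cyclic_on_orbit'[OF perm]] * by blast
    qed
    moreover have "(\<lambda>A. A - {y}) ` (orbit \<phi> ` (R - {y})) = cycles_on (R - {y}) \<phi>'"
      unfolding cycles_on_def image_image using orb by (intro image_cong) auto
    ultimately show ?thesis
      using cyc False card_image unfolding \<phi>'_def by fastforce
  qed
qed

text \<open>A transposition is its own inverse, so composing again undoes the contraction.
  Prescribing the value at \<open>u\<close> thus leaves a uniform permutation of the remaining
  points.\<close>

lemma bij_betw_contract:
  assumes "u \<in> R" "y \<in> R"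
  shows "bij_betw (\<lambda>\<phi>. \<phi> \<circ> transpose u y) {\<phi>. \<phi> permutes R \<and> \<phi> u = y} {\<phi>. \<phi> permutes R - {y}}"
proof (rule bij_betw_byWitness[where f' = "\<lambda>\<phi>. \<phi> \<circ> transpose u y"])
  show "(\<lambda>\<phi>. \<phi> \<circ> transpose u y) ` {\<phi>. \<phi> permutes R \<and> \<phi> u = y} \<subseteq> {\<phi>. \<phi> permutes R - {y}}"
    using assms contract_permutes[of _ R u y] by auto
  show "(\<lambda>\<phi>. \<phi> \<circ> transpose u y) ` {\<phi>. \<phi> permutes R - {y}} \<subseteq> {\<phi>. \<phi> permutes R \<and> \<phi> u = y}"
  proof clarsimp
    fix \<phi> assume \<phi>: "\<phi> permutes R - {y}"
    have "\<phi> permutes R" by (rule permutes_subset[OF \<phi>]) auto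
    then have "\<phi> \<circ> transpose u y permutes R"
      using assms by (intro permutes_compose permutes_swap_id)
    moreover have "\<phi> y = y" using \<phi> by (simp add: permutes_def)
    ultimately show "\<phi> \<circ> transpose u y permutes R \<and> \<phi> y = y" by simp
  qed
qed (auto simp: comp_assoc)

text \<open>
  Let \<open>\<tau> p = u\<close>. Revealing \<open>y = \<phi> u\<close> closes a cycle of \<open>\<phi>\<close> iff \<open>y = u\<close> and a cycle of \<open>\<phi> \<circ> \<tau>\<close> iff
  \<open>y = p\<close>. Contracting \<open>y\<close> out of both permutations leaves a pair of the same shape on \<open>R - {y}\<close>,
  with \<open>\<tau>\<close> replaced by the following permutation.
\<close>

definition reveal :: "('a \<Rightarrow> 'a) \<Rightarrow> 'a \<Rightarrow> 'a \<Rightarrow> 'a \<Rightarrow> 'a \<Rightarrow> 'a" where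
  "reveal \<tau> u p y = transpose u y \<circ> \<tau> \<circ> transpose p y"

definition cycle_sum :: "complex \<Rightarrow> complex \<Rightarrow> 'a set \<Rightarrow> ('a \<Rightarrow> 'a) \<Rightarrow> complex" where
  "cycle_sum a b R \<tau> =
     (\<Sum>\<phi> | \<phi> permutes R. a ^ card (cycles_on R \<phi>) * b ^ card (cycles_on R (\<phi> \<circ> \<tau>)))"

lemma reveal_permutes:
  assumes \<tau>: "\<tau> permutes R" and p: "\<tau> p = u" and "u \<in> R" "y \<in> R"
  shows "reveal \<tau> u p y permutes R - {y}"
proof (rule permutes_superset)
  have "p \<in> R" using assms by (metis permutes_in_image)
  then show "reveal \<tau> u p y permutes R"
    unfolding reveal_def using assms by (intro permutes_compose permutes_swap_id)
qed (use assms in \<open>auto simp: reveal_def\<close>)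

text \<open>Group the permutations by \<open>y = \<phi> u\<close>. The point \<open>u\<close> is
  arbitrary, and this freedom is what later allows \<open>u \<noteq> p\<close>.\<close>

lemma cycle_sum_rec:
  assumes \<tau>: "\<tau> permutes R" and R: "finite R" and u: "u \<in> R" and \<tau>p: "\<tau> p = u"
  shows "cycle_sum a b R \<tau> =
    (\<Sum>y\<in>R. (if y = u then a else 1) * (if y = p then b else 1) *
       cycle_sum a b (R - {y}) (reveal \<tau> u p y))"
proof -
  define f where "f \<phi> = a ^ card (cycles_on R \<phi>) * b ^ card (cycles_on R (\<phi> \<circ> \<tau>))" for \<phi>
  have p: "p \<in> R" using \<tau> u \<tau>p by (metis permutes_in_image)
  have "cycle_sum a b R \<tau> = (\<Sum>y\<in>R. \<Sum>\<phi> | \<phi> \<in> {\<phi>. \<phi> permutes R} \<and> \<phi> u = y. f \<phi>)"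
    unfolding cycle_sum_def f_def
    by (rule sum.group[symmetric]) (use R u in \<open>auto simp: finite_permutations permutes_in_image\<close>)
  also have "\<dots> = (\<Sum>y\<in>R. (if y = u then a else 1) * (if y = p then b else 1) *
       cycle_sum a b (R - {y}) (reveal \<tau> u p y))"
  proof (rule sum.cong[OF refl])
    fix y assume y: "y \<in> R"
    have "f \<phi> = (if y = u then a else 1) * (if y = p then b else 1) *
        (a ^ card (cycles_on (R - {y}) (\<phi> \<circ> transpose u y)) *
         b ^ card (cycles_on (R - {y}) ((\<phi> \<circ> transpose u y) \<circ> reveal \<tau> u p y)))"
      if \<phi>: "\<phi> permutes R" "\<phi> u = y" for \<phi>
    proof -
      have "\<phi> \<circ> \<tau> permutes R" using \<tau> \<phi> by (intro permutes_compose)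
      moreover have "(\<phi> \<circ> \<tau>) p = y" using \<tau>p \<phi> by simp
      \<comment> \<open>The value \<open>y\<close> is taken by \<open>\<phi> \<circ> \<tau>\<close>
        at \<open>p\<close>, so there the contraction uses \<open>transpose p y\<close>. The
        definition of \<open>reveal\<close> is the solution of this equation.\<close>
      moreover have "(\<phi> \<circ> transpose u y) \<circ> reveal \<tau> u p y = (\<phi> \<circ> \<tau>) \<circ> transpose p y"
        by (simp add: reveal_def fun_eq_iff)
      ultimately show ?thesis
        using card_cycles_contract[OF \<phi>(1) R u \<phi>(2)]
          card_cycles_contract[OF _ R p, of "\<phi> \<circ> \<tau>" y]
        by (simp add: f_def)
    qed
    then have "(\<Sum>\<phi> | \<phi> \<in> {\<phi>. \<phi> permutes R} \<and> \<phi> u = y. f \<phi>) =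
      (\<Sum>\<phi> | \<phi> permutes R \<and> \<phi> u = y. (if y = u then a else 1) * (if y = p then b else 1) *
        (a ^ card (cycles_on (R - {y}) (\<phi> \<circ> transpose u y)) *
         b ^ card (cycles_on (R - {y}) ((\<phi> \<circ> transpose u y) \<circ> reveal \<tau> u p y))))"
      by (intro sum.cong) auto
    also have "\<dots> = (\<Sum>\<phi> | \<phi> permutes R - {y}. (if y = u then a else 1) * (if y = p then b else 1) *
        (a ^ card (cycles_on (R - {y}) \<phi>) * b ^ card (cycles_on (R - {y}) (\<phi> \<circ> reveal \<tau> u p y))))"
      by (rule sum.reindex_bij_betw[OF bij_betw_contract[OF u y]])
    finally show "(\<Sum>\<phi> | \<phi> \<in> {\<phi>. \<phi> permutes R} \<and> \<phi> u = y. f \<phi>) =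
      (if y = u then a else 1) * (if y = p then b else 1) *
       cycle_sum a b (R - {y}) (reveal \<tau> u p y)"
      by (simp add: cycle_sum_def sum_distrib_left)
  qed
  finally show ?thesis .
qed

section \<open>Evolution of the number of fixed points\<close>

definition fixpts :: "'a set \<Rightarrow> ('a \<Rightarrow> 'a) \<Rightarrow> 'a set" where
  "fixpts R \<tau> = {x \<in> R. \<tau> x = x}"

text \<open>A point \<open>z \<noteq> p\<close> that was not fixed can become so only through
  \<open>\<tau> z = y\<close>, which is then swapped to \<open>u\<close>, so \<open>z = u\<close>.
  The point \<open>p\<close> is first swapped to \<open>y\<close> and needs
  \<open>\<tau> y = p\<close>. New fixed points thus arise for at most two values of
  \<open>y\<close>.\<close>

lemma fixpts_reveal_subset:
  assumes \<tau>: "\<tau> permutes R" and u: "\<tau> u \<noteq> u" and \<tau>p: "\<tau> p = u"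
  shows "fixpts (R - {y}) (reveal \<tau> u p y) \<subseteq>
    (fixpts R \<tau> - {y}) \<union> (if y = \<tau> u then {u} else {}) \<union>
    (if \<tau> y = p then {p} else {})"
proof
  fix z assume z: "z \<in> fixpts (R - {y}) (reveal \<tau> u p y)"
  have inj: "\<tau> v = \<tau> w \<longleftrightarrow> v = w" for v w
    using \<tau> by (meson permutes_inj injD)
  have zz: "z \<in> R" "z \<noteq> y" "transpose u y (\<tau> (transpose p y z)) = z"
    using z by (auto simp: fixpts_def reveal_def)
  show "z \<in> (fixpts R \<tau> - {y}) \<union> (if y = \<tau> u then {u} else {}) \<union>
    (if \<tau> y = p then {p} else {})"
  proof (cases "z = p")
    case True
    then have "transpose u y (\<tau> y) = p" using zz by simp
    have "\<tau> y \<noteq> u" using \<tau>p inj True zz(2) by metis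
    moreover have "\<tau> y \<noteq> y"
      using \<open>transpose u y (\<tau> y) = p\<close> \<tau>p u by auto
    ultimately have "\<tau> y = p" using \<open>transpose u y (\<tau> y) = p\<close> by simp
    then show ?thesis using True by simp
  next
    case False
    then have *: "transpose u y (\<tau> z) = z" using zz by simp
    have "\<tau> z \<noteq> u" using False \<tau>p inj by metis
    show ?thesis
    proof (cases "\<tau> z = y")
      case True
      then show ?thesis using * by auto
    next
      case False
      then have "\<tau> z = z" using * \<open>\<tau> z \<noteq> u\<close> by simp
      then show ?thesis using zz by (simp add: fixpts_def)
    qed
  qed
qed

text \<open>Each fixed point disappears for the one \<open>y\<close> equal to it, whence the
  \<open>- 1\<close>; the \<open>+ 2\<close> accounts for the two values of \<open>y\<close> that
  may create one.\<close>

lemma sum_card_fixpts_reveal: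
  assumes \<tau>: "\<tau> permutes R" and R: "finite R" and uR: "u \<in> R" and u: "\<tau> u \<noteq> u" and \<tau>p: "\<tau> p = u"
  shows "(\<Sum>y\<in>R. real (card (fixpts (R - {y}) (reveal \<tau> u p y)))) \<le>
    (real (card R) - 1) * card (fixpts R \<tau>) + 2"
proof -
  obtain q where q: "\<tau> q = p" using \<tau> by (metis permutes_def)
  have fin: "finite (fixpts R \<tau>)" using R by (simp add: fixpts_def)
  have sub: "fixpts R \<tau> \<subseteq> R" by (auto simp: fixpts_def)
  have "(\<Sum>y\<in>R. real (card (fixpts (R - {y}) (reveal \<tau> u p y)))) \<le>
    (\<Sum>y\<in>R. (real (card (fixpts R \<tau>)) - of_bool (y \<in> fixpts R \<tau>))
       + of_bool (y = \<tau> u) + of_bool (y = q))"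
  proof (rule sum_mono)
    fix y assume y: "y \<in> R"
    have iff: "\<tau> y = p \<longleftrightarrow> y = q" using \<tau> q by (metis permutes_inj injD)
    have "card (fixpts (R - {y}) (reveal \<tau> u p y)) \<le>
      card ((fixpts R \<tau> - {y}) \<union> (if y = \<tau> u then {u} else {}) \<union>
        (if \<tau> y = p then {p} else {}))"
      by (rule card_mono[OF _ fixpts_reveal_subset[OF \<tau> u \<tau>p]]) (use fin in auto)
    also have "\<dots> \<le> card (fixpts R \<tau> - {y}) + card (if y = \<tau> u then {u} else {})
       + card (if \<tau> y = p then {p} else {})"
      by (meson add_le_mono1 card_Un_le order_trans)
    also have "\<dots> = card (fixpts R \<tau> - {y}) + of_bool (y = \<tau> u) + of_bool (y = q)"
      using iff by (simp)
    finally have "real (card (fixpts (R - {y}) (reveal \<tau> u p y))) \<le>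
      real (card (fixpts R \<tau> - {y})) + of_bool (y = \<tau> u) + of_bool (y = q)"
      by (simp add: of_bool_def split: if_splits)
    moreover have "real (card (fixpts R \<tau> - {y})) =
      real (card (fixpts R \<tau>)) - of_bool (y \<in> fixpts R \<tau>)"
      using fin card_gt_0_iff[of "fixpts R \<tau>"]
      by (auto simp: card_Diff_singleton_if of_nat_diff)
    ultimately show "real (card (fixpts (R - {y}) (reveal \<tau> u p y))) \<le>
      (real (card (fixpts R \<tau>)) - of_bool (y \<in> fixpts R \<tau>))
       + of_bool (y = \<tau> u) + of_bool (y = q)" by simp
  qed
  also have "\<dots> \<le> (real (card R) - 1) * card (fixpts R \<tau>) + 2"
  proof -
    have "(\<Sum>y\<in>R. of_bool (y \<in> fixpts R \<tau>)) = real (card (fixpts R \<tau>))"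
      using sub R by (simp add: of_bool_def sum.If_cases Int_absorb1)
    moreover have "(\<Sum>y\<in>R. of_bool (y = z)) \<le> (1::real)" for z
      using R by (simp add: of_bool_def)
    ultimately show ?thesis
      using add_mono[of "\<Sum>z\<in>R. of_bool (z = \<tau> u)" "1::real" "\<Sum>z\<in>R. of_bool (z = q)" 1]
      by (simp add: sum.distrib sum_subtractf left_diff_distrib)
  qed
  finally show ?thesis .
qed

section \<open>The joint generating function of the cycle counts\<close>

text \<open>For one uniform permutation of \<open>k\<close> points, the generating function of the
  number of cycles at \<open>x\<close> is the product of \<open>1 + (x - 1) / j\<close> over
  \<open>j = 1..k\<close>. Here \<open>z = a + b - 2\<close> combines two such marks, and
  \<open>j = 1\<close> is left out because the last value closes a cycle of both
  permutations.\<close>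

definition ewens_prod :: "complex \<Rightarrow> nat \<Rightarrow> complex" where
  "ewens_prod z k = (\<Prod>j=2..k. 1 + z / of_nat j)"

lemma ewens_prod_Suc:
  "k \<ge> 1 \<Longrightarrow> ewens_prod z (Suc k) = ewens_prod z k * (1 + z / of_nat (Suc k))"
  by (simp add: ewens_prod_def)

text \<open>The factor is the average of \<open>a\<close>, \<open>b\<close> and \<open>j - 2\<close>
  ones, which makes sense only from \<open>j = 2\<close> on.\<close>

lemma norm_ewens_factor_le:
  fixes a b :: complex
  assumes "norm a = 1" "norm b = 1" "j \<ge> 2"
  shows "norm (1 + (a + b - 2) / of_nat j) \<le> 1"
proof -
  obtain m where j: "j = m + 2" using assms by (metis le_add_diff_inverse2)
  have "1 + (a + b - 2) / of_nat j = (of_nat m + a + b) / of_nat j"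
    using of_nat_neq_0[of "Suc m", where 'a = complex] by (simp add: j field_simps)
  moreover have "norm (of_nat m + a + b) \<le> real m + 1 + 1"
    using norm_triangle_ineq[of "of_nat m + a" b] norm_triangle_ineq[of "of_nat m" a] assms
    by simp
  ultimately show ?thesis
    using norm_of_nat[of j, where 'a = complex] by (simp only: norm_divide) (simp add: j)
qed

lemma norm_ewens_prod_le:
  assumes "norm a = 1" "norm b = 1"
  shows "norm (ewens_prod (a + b - 2) k) \<le> 1"
  unfolding ewens_prod_def prod_norm[symmetric]
  by (intro prod_le_1 conjI norm_ge_zero norm_ewens_factor_le assms) auto

text \<open>
  Stepping from \<open>\<tau>\<close> to a random \<^term>\<open>reveal \<tau> u p y\<close> with \<open>u\<close> not fixed, the expected
  number \<open>c\<close> of fixed points is at most \<open>(1 - 1/k) c + 2/k\<close>; only when everything is fixed are the two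
  closing events forced to coincide, which costs \<open>|a - 1| |b - 1| / k\<close>. The last factor below is a
  potential that is affine in \<open>c\<close>, does not increase on average in the first case, and drops by at least
  \<open>1/k\<close> in the second. It is at most 4 when \<open>c = 0\<close>.
\<close>

lemma norm_cycle_sum_approx:
  assumes a: "norm a = 1" and b: "norm b = 1"
    and "finite R" "card R = k" "k \<ge> 1" "\<tau> permutes R"
  shows "norm (cycle_sum a b R \<tau> / fact k - ewens_prod (a + b - 2) k) \<le>
    norm (a * b - 1) + norm (a - 1) * norm (b - 1) *
      (harm k / k * card (fixpts R \<tau>) + 4 - 2 * (1 + harm k) / k)"
  using \<open>k \<ge> 1\<close> assms(3,4,6)
proof (induction k arbitrary: R \<tau> rule: dec_induct)
  case base
  then obtain x where R: "R = {x}" by (metis card_1_singletonE One_nat_def)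
  then have \<tau>: "\<tau> x = x" using base by (metis permutes_in_image singletonD singletonI)
  \<comment> \<open>One point is left: the value is \<open>a * b\<close> against an empty product,
    the source of the term \<open>norm (a * b - 1)\<close>.\<close>
  have "cycle_sum a b R \<tau> = a * b * cycle_sum a b {} (reveal \<tau> x x x)"
    using cycle_sum_rec[of \<tau> R x x a b] base R \<tau> by simp
  moreover have "cycle_sum a b {} \<tau>' = 1" for \<tau>' :: "'a \<Rightarrow> 'a"
    by (simp add: cycle_sum_def cycles_on_def)
  moreover have "fixpts R \<tau> = {x}" using R \<tau> by (auto simp: fixpts_def)
  ultimately show ?case by (simp add: ewens_prod_def harm_def)
next
  case (step k R \<tau>)
  define z where "z = a + b - 2"
  define \<epsilon> where "\<epsilon> = norm (a - 1) * norm (b - 1)"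
  define \<eta> where "\<eta> = norm (a * b - 1)"
  define h :: real where "h = harm k"
  define c where "c = real (card (fixpts R \<tau>))"
  have \<epsilon>: "\<epsilon> \<ge> 0" by (simp add: \<epsilon>_def)
  have h0: "h \<ge> 0" unfolding h_def by (rule harm_nonneg)
  have k: "real k \<ge> 1" using step by simp
  have hK: "harm (Suc k) = h + 1 / real (Suc k)" by (simp add: h_def harm_Suc inverse_eq_divide)
  have \<tau>: "\<tau> permutes R" and R: "finite R" and cardR: "card R = Suc k" using step by auto
  have Rne: "R \<noteq> {}" using cardR by auto
  have inj: "\<tau> v = \<tau> w \<longleftrightarrow> v = w" for v w using \<tau> by (meson permutes_inj injD)
  \<comment> \<open>This serves both cases. As \<open>norm (f y) = 1\<close>, replacing every
    smaller sum by \<open>ewens_prod z k\<close> costs the average of the inductive bounds; these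
    are affine in the number of fixed points, so only its mean enters.\<close>
  have approx: "norm (cycle_sum a b R \<tau> / fact (Suc k) - ewens_prod z k * ((\<Sum>y\<in>R. f y) / of_nat (Suc k))) \<le>
      \<eta> + \<epsilon> * (h / k * ((\<Sum>y\<in>R. real (card (fixpts (R - {y}) (reveal \<tau> u p y)))) / Suc k)
        + 4 - 2 * (1 + h) / k)"
    if u: "u \<in> R" "\<tau> p = u" and f: "f = (\<lambda>y. (if y = u then a else 1) * (if y = p then b else 1))" for u p f
  proof -
    define w where "w y = cycle_sum a b (R - {y}) (reveal \<tau> u p y) / fact k" for y
    have rec: "cycle_sum a b R \<tau> / fact (Suc k) = (\<Sum>y\<in>R. f y * w y) / of_nat (Suc k)"
      using cycle_sum_rec[OF \<tau> R u, of a b] unfolding f w_def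
      by (simp add: sum_divide_distrib mult.commute)
    have "cycle_sum a b R \<tau> / fact (Suc k) - ewens_prod z k * ((\<Sum>y\<in>R. f y) / of_nat (Suc k))
       = (\<Sum>y\<in>R. f y * (w y - ewens_prod z k)) / of_nat (Suc k)"
    proof -
      have "(\<Sum>y\<in>R. f y * (w y - ewens_prod z k)) =
          (\<Sum>y\<in>R. f y * w y) - ewens_prod z k * (\<Sum>y\<in>R. f y)"
        by (simp only: right_diff_distrib sum_subtractf sum_distrib_left
            mult.commute[of "ewens_prod z k"])
      then show ?thesis
        by (simp only: rec diff_divide_distrib times_divide_eq_right)
    qed
    also have "norm \<dots> = norm (\<Sum>y\<in>R. f y * (w y - ewens_prod z k)) / real (Suc k)"
      by (simp add: norm_divide del: of_nat_Suc)
    also have "\<dots> \<le> (\<Sum>y\<in>R. \<eta> + \<epsilon> * (h / k * real (card (fixpts (R - {y}) (reveal \<tau> u p y)))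
        + 4 - 2 * (1 + h) / k)) / real (Suc k)"
    proof (intro divide_right_mono sum_norm_le)
      fix y assume y: "y \<in> R"
      have "norm (f y) = 1" using a b by (simp add: f norm_mult)
      then have "norm (f y * (w y - ewens_prod z k)) = norm (w y - ewens_prod z k)"
        by (simp add: norm_mult)
      also have "\<dots> \<le> \<eta> + \<epsilon> * (h / k * real (card (fixpts (R - {y}) (reveal \<tau> u p y)))
        + 4 - 2 * (1 + h) / k)"
        using step.IH[of "R - {y}" "reveal \<tau> u p y"] R cardR y reveal_permutes[OF \<tau> u(2,1) y]
        unfolding w_def \<eta>_def \<epsilon>_def h_def z_def by simp
      finally show "norm (f y * (w y - ewens_prod z k)) \<le> \<dots>" .
    qed simp
    also have "\<dots> = \<eta> + \<epsilon> * (h / k * ((\<Sum>y\<in>R. real (card (fixpts (R - {y}) (reveal \<tau> u p y)))) / Suc k)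
        + 4 - 2 * (1 + h) / k)"
    proof -
      define D where "D = 4 - 2 * (1 + h) / k"
      define r where "r y = real (card (fixpts (R - {y}) (reveal \<tau> u p y)))" for y
      have "(\<Sum>y\<in>R. \<eta> + \<epsilon> * (h / k * r y + 4 - 2 * (1 + h) / k)) =
          (\<Sum>y\<in>R. (\<eta> + \<epsilon> * D) + (\<epsilon> * (h / k)) * r y)"
        by (rule sum.cong) (auto simp: D_def algebra_simps)
      also have "(\<Sum>y\<in>R. (\<eta> + \<epsilon> * D) + (\<epsilon> * (h / k)) * r y) =
          real (Suc k) * (\<eta> + \<epsilon> * D) + (\<epsilon> * (h / k)) * (\<Sum>y\<in>R. r y)"
        by (simp add: sum.distrib sum_distrib_left cardR)
      also have "(real (Suc k) * (\<eta> + \<epsilon> * D) + (\<epsilon> * (h / k)) * (\<Sum>y\<in>R. r y)) / real (Suc k) =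
          \<eta> + \<epsilon> * (h / k * ((\<Sum>y\<in>R. r y) / Suc k) + D)"
        by (simp add: add_divide_distrib algebra_simps del: of_nat_Suc)
      finally show ?thesis by (simp only: D_def r_def add_diff_eq)
    qed
    finally show ?thesis .
  qed
  \<comment> \<open>Here the summand 1 beside \<open>h\<close> is used:
    \<open>2 * (1 + h) / k - 2 * (1 + h) / Suc k\<close> is
    \<open>2 * (1 + h) / (k * Suc k)\<close>. The share of \<open>h\<close> absorbs the newly
    created fixed points, the share of 1 the growth of \<open>harm\<close>.\<close>
  have H: "2 * h / (k * Suc k) + 2 * (1 + harm (Suc k)) / Suc k \<le> 2 * (1 + h) / k"
  proof -
    have "2 * h / (x * y) + 2 * (1 + (h + 1 / y)) / y \<le> 2 * (1 + h) / x"
      if "x \<ge> 1" "y = x + 1" for x y :: real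
    proof -
      have "x > 0" "y > 0" using that by auto
      then have "2 * h / (x * y) + 2 * (1 + (h + 1 / y)) / y = (2 * h + 2 * (1 + h) * x) / (x * y) + 2 / (y * y)"
        by (simp add: field_simps)
      also have "2 / (y * y) \<le> 2 / (x * y)"
        using that by (intro divide_left_mono mult_right_mono) auto
      also have "(2 * h + 2 * (1 + h) * x) / (x * y) + 2 / (x * y) = 2 * (1 + h) * y / (x * y)"
        using that by (simp add: add_divide_distrib[symmetric] algebra_simps)
      also have "\<dots> = 2 * (1 + h) / x" using \<open>y > 0\<close> by simp
      finally show ?thesis by simp
    qed
    from this[OF k, of "real (Suc k)"] show ?thesis unfolding hK of_nat_mult by simp
  qed
  then have H': "2 * (1 + harm (Suc k)) / Suc k \<le> 2 * (1 + h) / k"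
    using k h0 by (smt (verit) divide_nonneg_nonneg mult_nonneg_nonneg of_nat_0_le_iff)
  have "norm (cycle_sum a b R \<tau> / fact (Suc k) - ewens_prod z (Suc k)) \<le>
    \<eta> + \<epsilon> * (harm (Suc k) / Suc k * c + 4 - 2 * (1 + harm (Suc k)) / Suc k)"
  proof (cases "\<exists>u\<in>R. \<tau> u \<noteq> u")
    case True
    then obtain u where u: "u \<in> R" "\<tau> u \<noteq> u" by blast
    obtain p where p: "\<tau> p = u" using \<tau> by (metis permutes_def)
    have pR: "p \<in> R" using p u \<tau> by (metis permutes_in_image)
    have pu: "p \<noteq> u" using p u by auto
    define f where "f = (\<lambda>y. (if y = u then a else 1) * (if y = p then b else 1))"
    \<comment> \<open>Disjoint closing events: one \<open>y\<close> weighs \<open>a\<close>, another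
      \<open>b\<close>, the other \<open>k - 1\<close> weigh 1, and the mean is exactly the next
      factor of \<open>ewens_prod\<close>.\<close>
    have "(\<Sum>y\<in>R. f y) = (\<Sum>y\<in>R. 1 + (if y = u then a - 1 else 0) + (if y = p then b - 1 else 0))"
      using pu by (intro sum.cong) (auto simp: f_def)
    also have "\<dots> = of_nat (Suc k) + z"
      using R u pR cardR by (simp add: sum.distrib z_def)
    finally have "(\<Sum>y\<in>R. f y) / of_nat (Suc k) = 1 + z / of_nat (Suc k)"
      by (simp add: add_divide_distrib del: of_nat_Suc)
    then have "norm (cycle_sum a b R \<tau> / fact (Suc k) - ewens_prod z (Suc k)) \<le>
      \<eta> + \<epsilon> * (h / k * ((\<Sum>y\<in>R. real (card (fixpts (R - {y}) (reveal \<tau> u p y)))) / Suc k)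
        + 4 - 2 * (1 + h) / k)"
      using approx[OF u(1) p f_def] ewens_prod_Suc[of k z] step by simp
    also have "\<dots> \<le> \<eta> + \<epsilon> * (harm (Suc k) / Suc k * c + 4 - 2 * (1 + harm (Suc k)) / Suc k)"
    proof (intro add_left_mono mult_left_mono \<epsilon>)
      have "(\<Sum>y\<in>R. real (card (fixpts (R - {y}) (reveal \<tau> u p y)))) \<le> real k * c + 2"
        using sum_card_fixpts_reveal[OF \<tau> R u p] cardR by (simp add: c_def)
      then have "h / k * ((\<Sum>y\<in>R. real (card (fixpts (R - {y}) (reveal \<tau> u p y)))) / Suc k) \<le>
        h / k * ((real k * c + 2) / Suc k)"
        using h0 k by (intro mult_left_mono divide_right_mono) auto
      also have "\<dots> = h / Suc k * c + 2 * h / (k * Suc k)"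
      proof -
        have "h / x * ((x * c + 2) / y) = h / y * c + 2 * h / (x * y)" if "x \<noteq> 0" for x y
          using that by (simp add: add_divide_distrib distrib_left)
        from this[of "real k" "real (Suc k)"] show ?thesis using k by (simp only: of_nat_mult)
      qed
      also have "h / Suc k * c \<le> harm (Suc k) / Suc k * c"
        unfolding hK by (intro mult_right_mono divide_right_mono) (auto simp: c_def)
      finally show "h / k * ((\<Sum>y\<in>R. real (card (fixpts (R - {y}) (reveal \<tau> u p y)))) / Suc k)
        + 4 - 2 * (1 + h) / k \<le> harm (Suc k) / Suc k * c + 4 - 2 * (1 + harm (Suc k)) / Suc k"
        using H by linarith
    qed
    finally show ?thesis .
  next
    case False
    then have fix_all: "\<tau> u = u" if "u \<in> R" for u using that by blast
    obtain u where u: "u \<in> R" using Rne by blast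
    have c: "c = Suc k"
    proof -
      have "fixpts R \<tau> = R" using fix_all by (auto simp: fixpts_def)
      then show ?thesis using cardR by (simp add: c_def)
    qed
    define f where "f = (\<lambda>y. (if y = u then a else 1) * (if y = u then b else 1))"
    \<comment> \<open>Now \<open>p = u\<close> for every choice of \<open>u\<close>. The excess over
      the wanted factor comes from
      \<open>a * b - 1 = (a - 1) + (b - 1) + (a - 1) * (b - 1)\<close>.\<close>
    have "(\<Sum>y\<in>R. f y) = (\<Sum>y\<in>R. 1 + (if y = u then a * b - 1 else 0))"
      by (intro sum.cong) (auto simp: f_def)
    also have "\<dots> = of_nat (Suc k) + z + (a - 1) * (b - 1)"
      using R u cardR by (simp add: sum.distrib z_def algebra_simps)
    finally have sumf: "(\<Sum>y\<in>R. f y) / of_nat (Suc k) =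
        1 + z / of_nat (Suc k) + (a - 1) * (b - 1) / of_nat (Suc k)"
      by (simp add: add_divide_distrib del: of_nat_Suc)
    define A where "A = cycle_sum a b R \<tau> / fact (Suc k) - ewens_prod z k * ((\<Sum>y\<in>R. f y) / of_nat (Suc k))"
    define B where "B = ewens_prod z k * ((a - 1) * (b - 1) / of_nat (Suc k))"
    have "cycle_sum a b R \<tau> / fact (Suc k) - ewens_prod z (Suc k) = A + B"
      using ewens_prod_Suc[of k z] step unfolding A_def B_def sumf by (simp add: algebra_simps)
    then have "norm (cycle_sum a b R \<tau> / fact (Suc k) - ewens_prod z (Suc k)) \<le> norm A + norm B"
      by (simp add: norm_triangle_ineq)
    also have "norm B \<le> 1 * (\<epsilon> / Suc k)"
      unfolding B_def z_def
      by (subst norm_mult, intro mult_mono norm_ewens_prod_le a b) (auto simp: norm_divide norm_mult \<epsilon>_def simp del: of_nat_Suc)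
    also have "norm A \<le> \<eta> + \<epsilon> * (h / k * ((\<Sum>y\<in>R. real (card (fixpts (R - {y}) (reveal \<tau> u u y)))) / Suc k)
        + 4 - 2 * (1 + h) / k)"
      unfolding A_def by (rule approx[OF u fix_all[OF u] f_def])
    \<comment> \<open>The linear part of the potential is at most \<open>h\<close> with
      \<open>k\<close> points left and \<open>harm (Suc k) = h + 1 / Suc k\<close> with
      \<open>Suc k\<close>; the difference pays for \<open>norm B\<close>.\<close>
    also have "\<dots> \<le> \<eta> + \<epsilon> * (h + 4 - 2 * (1 + h) / k)"
    proof (intro add_left_mono mult_left_mono \<epsilon> diff_right_mono add_right_mono)
      have "(\<Sum>y\<in>R. real (card (fixpts (R - {y}) (reveal \<tau> u u y)))) \<le> (\<Sum>y\<in>R. real k)"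
      proof (rule sum_mono)
        fix y assume "y \<in> R"
        have "card (fixpts (R - {y}) (reveal \<tau> u u y)) \<le> card (R - {y})"
          by (rule card_mono) (use R in \<open>auto simp: fixpts_def\<close>)
        then show "real (card (fixpts (R - {y}) (reveal \<tau> u u y))) \<le> real k"
          using \<open>y \<in> R\<close> R cardR by simp
      qed
      then have "h / k * ((\<Sum>y\<in>R. real (card (fixpts (R - {y}) (reveal \<tau> u u y)))) / Suc k) \<le>
        h / k * (real (Suc k) * real k / Suc k)"
        using h0 k cardR by (intro mult_left_mono divide_right_mono) auto
      also have "\<dots> = h" using k by (simp del: of_nat_Suc)
      finally show "h / k * ((\<Sum>y\<in>R. real (card (fixpts (R - {y}) (reveal \<tau> u u y)))) / Suc k) \<le> h" .
    qed
    finally have "norm (cycle_sum a b R \<tau> / fact (Suc k) - ewens_prod z (Suc k)) \<le>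
       \<eta> + \<epsilon> * (h + 4 - 2 * (1 + h) / k) + 1 * (\<epsilon> / Suc k)" by simp
    also have "\<dots> = \<eta> + \<epsilon> * (harm (Suc k) + 4 - 2 * (1 + h) / k)"
      unfolding hK by (simp add: algebra_simps del: of_nat_Suc)
    also have "\<dots> \<le> \<eta> + \<epsilon> * (harm (Suc k) + 4 - 2 * (1 + harm (Suc k)) / Suc k)"
      using H' by (intro add_left_mono mult_left_mono \<epsilon>) linarith
    finally show ?thesis using c by (simp del: of_nat_Suc)
  qed
  then show ?case unfolding z_def \<eta>_def \<epsilon>_def c_def .
qed

corollary norm_cycle_sum_derangement_approx:
  assumes "norm a = 1" "norm b = 1" "finite R" "R \<noteq> {}" "\<tau> permutes R" "\<And>x. x \<in> R \<Longrightarrow> \<tau> x \<noteq> x"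
  shows "norm (cycle_sum a b R \<tau> / fact (card R) - ewens_prod (a + b - 2) (card R)) \<le>
    norm (a * b - 1) + 4 * (norm (a - 1) * norm (b - 1))"
proof -
  have fix0: "fixpts R \<tau> = {}" using assms by (auto simp: fixpts_def)
  have h: "harm (card R) \<ge> (0::real)" by (rule harm_nonneg)
  have "card R \<ge> 1" using assms by (simp add: Suc_leI card_gt_0_iff)
  then have "norm (cycle_sum a b R \<tau> / fact (card R) - ewens_prod (a + b - 2) (card R)) \<le>
    norm (a * b - 1) + norm (a - 1) * norm (b - 1) * (4 - 2 * (1 + harm (card R)) / card R)"
    using norm_cycle_sum_approx[of a b R "card R" \<tau>] assms fix0 by simp
  also have "norm (a - 1) * norm (b - 1) * (4 - 2 * (1 + harm (card R)) / card R) \<le>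
    norm (a - 1) * norm (b - 1) * 4"
    using h by (intro mult_left_mono) auto
  finally show ?thesis by simp
qed

section \<open>Asymptotics of the product\<close>

lemma sum_inverse_squares_le:
  assumes "k \<ge> 1"
  shows "(\<Sum>j=2..k. 1 / real j ^ 2) \<le> 1 - 1 / real k"
  using assms
proof (induction k rule: dec_induct)
  case (step k)
  have "1 / real (Suc k) ^ 2 \<le> 1 / (real k * real (Suc k))"
    using step by (intro divide_left_mono) (auto simp: power2_eq_square intro!: mult_right_mono)
  also have "\<dots> = 1 / real k - 1 / real (Suc k)"
    using step by (simp add: field_simps)
  finally show ?case using step by simp
qed simp

text \<open>Every \<open>1 + z / j\<close> lies in the closed unit disc as an average, every
  \<open>exp (z / j)\<close> because \<open>Re z \<le> 0\<close>, so the products differ by at most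
  the sum of the differences of the factors. Those are second-order Taylor remainders, and the
  \<open>1 / j^2\<close> from \<open>j = 2\<close> on sum to at most 1.\<close>

lemma norm_ewens_prod_exp_le:
  fixes a b :: complex
  assumes a: "norm a = 1" and b: "norm b = 1" and k: "k \<ge> 1" and z: "z = a + b - 2"
  shows "norm (ewens_prod z k - exp (z * (harm k - 1))) \<le> exp (norm z) * norm z ^ 2"
proof -
  have Re: "Re z \<le> 0"
    using complex_Re_le_cmod[of a] complex_Re_le_cmod[of b] a b z by simp
  have "harm k = (\<Sum>j=1..k. 1 / of_nat j :: complex)"
    by (simp add: harm_def inverse_eq_divide)
  then have "harm k - 1 = (\<Sum>j=2..k. 1 / of_nat j :: complex)"
    using k by (simp add: sum.atLeast_Suc_atMost numeral_2_eq_2)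
  then have "exp (z * (harm k - 1)) = (\<Prod>j=2..k. exp (z / of_nat j))"
    by (simp add: exp_sum sum_distrib_left)
  then have "norm (ewens_prod z k - exp (z * (harm k - 1))) \<le>
      (\<Sum>j=2..k. norm (1 + z / of_nat j - exp (z / of_nat j)))"
    unfolding ewens_prod_def using norm_ewens_factor_le[OF a b] Re
    by (simp only:) (intro norm_prod_diff, auto simp: z Re_divide_of_nat divide_nonpos_nonneg)
  also have "\<dots> \<le> (\<Sum>j=2..k. exp (norm z) * norm z ^ 2 * (1 / real j ^ 2))"
  proof (rule sum_mono)
    fix j assume j: "j \<in> {2..k}"
    have le: "norm (z / of_nat j) \<le> norm z"
      using j by (simp add: norm_divide divide_le_eq mult_le_cancel_left1)
    have "norm (exp (z / of_nat j) - (\<Sum>i\<le>1. (z / of_nat j) ^ i / fact i)) \<le>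
        exp (norm (z / of_nat j)) * (norm (z / of_nat j) ^ Suc 1) / fact 1"
      by (rule Taylor_exp_field)
    also have "\<dots> \<le> exp (norm z) * norm (z / of_nat j) ^ 2"
      using le by (simp add: power2_eq_square mult_right_mono)
    also have "\<dots> = exp (norm z) * norm z ^ 2 * (1 / real j ^ 2)"
      by (simp add: norm_divide power_divide)
    finally show "norm (1 + z / of_nat j - exp (z / of_nat j)) \<le> \<dots>"
      by (simp add: norm_minus_commute)
  qed
  also have "\<dots> \<le> exp (norm z) * norm z ^ 2 * 1"
    unfolding sum_distrib_left[symmetric] using sum_inverse_squares_le[OF k]
    by (intro mult_left_mono) (auto intro: order_trans)
  finally show ?thesis by simp
qed

text \<open>The term \<open>s * sqrt L\<close> will be cancelled by the centring,
  \<open>s^2 / 2\<close> becomes the Gaussian exponent, and the cubic remainder is multiplied by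
  \<open>L\<close> only.\<close>

lemma iexp_second_order:
  assumes "L > 0"
  shows "norm (of_real L * (iexp (s / sqrt L) - 1) - \<i> * of_real (s * sqrt L) + of_real (s ^ 2 / 2))
    \<le> \<bar>s\<bar> ^ 3 / (6 * sqrt L)"
proof -
  define x where "x = s / sqrt L"
  have L: "L = sqrt L ^ 2" using assms by simp
  have "norm (iexp x - (\<Sum>k\<le>2. (\<i> * x)^k / fact k)) \<le> \<bar>x\<bar>^(Suc 2) / fact (Suc 2)"
    by (rule iexp_approx1)
  then have 1: "norm (iexp x - (1 + \<i> * x - x ^ 2 / 2)) \<le> \<bar>x\<bar> ^ 3 / 6"
    by (simp add: numeral_2_eq_2 fact_numeral power_mult_distrib power3_eq_cube algebra_simps)
  have "of_real L * (iexp x - 1) - \<i> * of_real (s * sqrt L) + of_real (s ^ 2 / 2) =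
      of_real L * (iexp x - (1 + \<i> * x - x ^ 2 / 2))"
  proof -
    have "L * x = s * sqrt L" "L * x ^ 2 = s ^ 2"
      using assms by (auto simp: x_def power_divide) (metis L nonzero_mult_div_cancel_left mult.assoc mult.commute power2_eq_square real_sqrt_gt_0_iff less_numeral_extra(3) times_divide_eq_right times_divide_eq_left)
    then have "complex_of_real L * x = s * sqrt L" "complex_of_real L * x ^ 2 = s ^ 2"
      by (metis of_real_mult, metis of_real_mult of_real_power)
    then show ?thesis by (simp add: algebra_simps)
  qed
  also have "norm \<dots> = L * norm (iexp x - (1 + \<i> * x - x ^ 2 / 2))"
    using assms by (simp add: norm_mult)
  also have "\<dots> \<le> L * (\<bar>x\<bar> ^ 3 / 6)" using 1 assms by (intro mult_left_mono) auto
  also have "\<dots> = \<bar>s\<bar> ^ 3 / (6 * sqrt L)"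
    using assms by (simp add: x_def power_divide power3_eq_cube abs_mult)
  finally show ?thesis by (simp add: x_def)
qed

lemma ln_real_at_top: "filterlim (\<lambda>n. ln (real n)) at_top sequentially"
  by (rule filterlim_compose[OF ln_at_top filterlim_real_sequentially])

lemma tendsto_iexp_1: "(\<lambda>n. iexp (s / sqrt (ln (real n)))) \<longlonglongrightarrow> 1"
proof -
  have "(\<lambda>n. s / sqrt (ln (real n))) \<longlonglongrightarrow> 0"
    by (rule real_tendsto_divide_at_top[OF tendsto_const
          filterlim_compose[OF sqrt_at_top ln_real_at_top]])
  then have "(\<lambda>n. iexp (s / sqrt (ln (real n)))) \<longlonglongrightarrow> iexp 0"
    by (intro tendsto_intros)
  then show ?thesis by simp
qed

text \<open>The exponent \<open>z n * (harm (2 * n) - 1)\<close> equals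
  \<open>L n * z n + z n * d n\<close>. The convergent \<open>d n\<close> collects Euler's constant,
  \<open>ln 2\<close> and the omitted \<open>j = 1\<close>; it does not matter, since
  \<open>z n\<close> tends to 0.\<close>

lemma ewens_prod_clt:
  "(\<lambda>n. ewens_prod (iexp (s / sqrt (ln (real n))) + iexp (t / sqrt (ln (real n))) - 2) (2 * n)
      * iexp (- ((s + t) * sqrt (ln (real n)))))
   \<longlonglongrightarrow> of_real (exp (- s\<^sup>2 / 2) * exp (- t\<^sup>2 / 2))"
proof -
  define L where "L n = ln (real n)" for n
  define z where "z n = iexp (s / sqrt (L n)) + iexp (t / sqrt (L n)) - 2" for n
  define d where "d n = harm (2 * n) - 1 - L n" for n
  have z0: "z \<longlonglongrightarrow> 0"
    unfolding z_def L_def using tendsto_diff[OF tendsto_add[OF tendsto_iexp_1 tendsto_iexp_1] tendsto_const[of 2]]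
    by simp
  have d: "d \<longlonglongrightarrow> euler_mascheroni + ln 2 - 1"
  proof -
    have "(\<lambda>n. (harm (2 * n) - ln (real (2 * n))) + ln 2 - 1) \<longlonglongrightarrow> euler_mascheroni + ln 2 - 1"
      by (intro tendsto_intros filterlim_compose[OF euler_mascheroni_LIMSEQ]
           filterlim_subseq) (auto simp: strict_mono_def)
    moreover have "\<forall>\<^sub>F n in sequentially. (harm (2 * n) - ln (real (2 * n))) + ln 2 - 1 = d n"
      using eventually_gt_at_top[of 0]
      by eventually_elim (simp add: d_def L_def ln_mult)
    ultimately show ?thesis by (rule Lim_transform_eventually)
  qed
  have L_pos: "\<forall>\<^sub>F n in sequentially. L n > 0"
    unfolding L_def using eventually_gt_at_top[of 1] by eventually_elim simp
  define r where "r n = of_real (L n) * z n - \<i> * of_real ((s + t) * sqrt (L n)) + of_real ((s\<^sup>2 + t\<^sup>2) / 2)" for n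
  have r: "r \<longlonglongrightarrow> 0"
  proof (rule Lim_null_comparison)
    show "\<forall>\<^sub>F n in sequentially. norm (r n) \<le> (\<bar>s\<bar> ^ 3 / 6 + \<bar>t\<bar> ^ 3 / 6) / sqrt (L n)"
      using L_pos
    proof eventually_elim
      case (elim n)
      have "r n = (of_real (L n) * (iexp (s / sqrt (L n)) - 1) - \<i> * of_real (s * sqrt (L n)) + of_real (s ^ 2 / 2))
         + (of_real (L n) * (iexp (t / sqrt (L n)) - 1) - \<i> * of_real (t * sqrt (L n)) + of_real (t ^ 2 / 2))"
        by (simp add: r_def z_def algebra_simps add_divide_distrib)
      also have "norm \<dots> \<le> \<bar>s\<bar> ^ 3 / (6 * sqrt (L n)) + \<bar>t\<bar> ^ 3 / (6 * sqrt (L n))"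
        by (intro norm_triangle_le add_mono iexp_second_order elim)
      finally show ?case by (simp add: add_divide_distrib)
    qed
    show "(\<lambda>n. (\<bar>s\<bar> ^ 3 / 6 + \<bar>t\<bar> ^ 3 / 6) / sqrt (L n)) \<longlonglongrightarrow> 0"
      unfolding L_def by (rule real_tendsto_divide_at_top[OF tendsto_const
          filterlim_compose[OF sqrt_at_top ln_real_at_top]])
  qed
  have "(\<lambda>n. exp (r n - of_real ((s\<^sup>2 + t\<^sup>2) / 2) + z n * of_real (d n))) \<longlonglongrightarrow>
      exp (0 - of_real ((s\<^sup>2 + t\<^sup>2) / 2) + 0 * of_real (euler_mascheroni + ln 2 - 1))"
    by (intro tendsto_intros r z0 d)
  also have "exp (0 - of_real ((s\<^sup>2 + t\<^sup>2) / 2) + 0 * of_real (euler_mascheroni + ln 2 - 1)) =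
      complex_of_real (exp (- s\<^sup>2 / 2) * exp (- t\<^sup>2 / 2))"
    unfolding exp_add[symmetric] by (simp add: exp_of_real[symmetric] diff_divide_distrib add_divide_distrib)
  also have "(\<lambda>n. exp (r n - of_real ((s\<^sup>2 + t\<^sup>2) / 2) + z n * of_real (d n))) =
      (\<lambda>n. exp (z n * (harm (2 * n) - 1)) * iexp (- ((s + t) * sqrt (L n))))"
  proof
    fix n
    have "harm (2 * n) = complex_of_real (harm (2 * n))"
      by (simp add: harm_def)
    then show "exp (r n - of_real ((s\<^sup>2 + t\<^sup>2) / 2) + z n * of_real (d n)) =
        exp (z n * (harm (2 * n) - 1)) * iexp (- ((s + t) * sqrt (L n)))"
      by (simp add: r_def d_def exp_add[symmetric] algebra_simps)
  qed
  finally have main: "(\<lambda>n. exp (z n * (harm (2 * n) - 1)) * iexp (- ((s + t) * sqrt (L n)))) \<longlonglongrightarrow>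
      complex_of_real (exp (- s\<^sup>2 / 2) * exp (- t\<^sup>2 / 2))" .
  have "(\<lambda>n. ewens_prod (z n) (2 * n) * iexp (- ((s + t) * sqrt (L n))) -
      exp (z n * (harm (2 * n) - 1)) * iexp (- ((s + t) * sqrt (L n)))) \<longlonglongrightarrow> 0"
  proof (rule Lim_null_comparison)
    show "\<forall>\<^sub>F n in sequentially. norm (ewens_prod (z n) (2 * n) * iexp (- ((s + t) * sqrt (L n))) -
      exp (z n * (harm (2 * n) - 1)) * iexp (- ((s + t) * sqrt (L n)))) \<le> exp (norm (z n)) * norm (z n) ^ 2"
      using eventually_ge_at_top[of 1]
    proof eventually_elim
      case (elim n)
      have "norm (ewens_prod (z n) (2 * n) - exp (z n * (harm (2 * n) - 1))) \<le> exp (norm (z n)) * norm (z n) ^ 2"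
        by (rule norm_ewens_prod_exp_le[OF _ _ _ z_def]) (use elim in auto)
      then show ?case
        by (simp add: left_diff_distrib[symmetric] norm_mult del: of_real_mult)
    qed
    have "(\<lambda>n. exp (norm (z n)) * norm (z n) ^ 2) \<longlonglongrightarrow> exp (norm (0::complex)) * norm (0::complex) ^ 2"
      by (intro tendsto_intros z0)
    then show "(\<lambda>n. exp (norm (z n)) * norm (z n) ^ 2) \<longlonglongrightarrow> 0" by simp
  qed
  from tendsto_add[OF this main] show ?thesis
    by (simp add: z_def L_def)
qed

section \<open>Transitivity\<close>

lemma perm_restrict_permutes:
  assumes "\<phi> permutes S" "\<phi> ` A = A"
  shows "perm_restrict \<phi> A permutes A"
proof (rule bij_imp_permutes)
  have "bij_betw \<phi> A A"
    using assms permutes_inj_on[of \<phi> S A] by (simp add: bij_betw_def)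
  then show "bij_betw (perm_restrict \<phi> A) A A"
    by (rule bij_betw_cong[THEN iffD1, rotated]) (simp add: perm_restrict_def)
qed (simp add: perm_restrict_def)

lemma card_permutations_preserving_le:
  assumes S: "finite S" and A: "A \<subseteq> S"
  shows "card {\<phi>. \<phi> permutes S \<and> \<phi> ` A = A} \<le> fact (card A) * fact (card S - card A)"
proof -
  have fin: "finite A" "finite (S - A)" using S A finite_subset by auto
  let ?f = "\<lambda>\<phi>. (perm_restrict \<phi> A, perm_restrict \<phi> (S - A))"
  let ?P = "{\<phi>. \<phi> permutes S \<and> \<phi> ` A = A}"
  have "?f ` ?P \<subseteq> {p. p permutes A} \<times> {p. p permutes S - A}"
  proof (intro image_subsetI)
    fix \<phi> assume \<phi>: "\<phi> \<in> ?P"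
    then have "\<phi> ` (S - A) = S - A"
      using permutes_image[of \<phi> S] permutes_inj[of \<phi> S] by (simp add: image_set_diff)
    then show "?f \<phi> \<in> {p. p permutes A} \<times> {p. p permutes S - A}"
      using \<phi> perm_restrict_permutes[of \<phi> S] by auto
  qed
  moreover have "inj_on ?f ?P"
  proof (intro inj_onI ext)
    fix \<phi> \<psi> x assume *: "\<phi> \<in> ?P" "\<psi> \<in> ?P" "?f \<phi> = ?f \<psi>"
    then have "perm_restrict \<phi> A x = perm_restrict \<psi> A x"
      "perm_restrict \<phi> (S - A) x = perm_restrict \<psi> (S - A) x" by auto
    then show "\<phi> x = \<psi> x"
      using * A by (cases "x \<in> A"; cases "x \<in> S") (auto simp: perm_restrict_def permutes_def)
  qed
  ultimately have "card ?P \<le> card ({p. p permutes A} \<times> {p. p permutes S - A})"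
    by (intro card_inj_on_le[of ?f]) (auto simp: finite_permutations fin)
  also have "\<dots> = fact (card A) * fact (card S - card A)"
    using fin A S by (simp add: card_cartesian_product card_permutations card_Diff_subset)
  finally show ?thesis .
qed

text \<open>This is one term of Vandermonde's sum. In the union bound below,
  \<open>n choose j\<close> invariant sets of size \<open>2 * j\<close> each carry probability
  \<open>1 / ((2 * n) choose (2 * j))\<close>, so together at most
  \<open>1 / (n choose j)\<close>.\<close>

lemma choose_square_le: "(n choose j)\<^sup>2 \<le> (2 * n) choose (2 * j)"
proof -
  have "(n choose j) * (n choose (2 * j - j)) \<le> (\<Sum>k\<le>2 * j. (n choose k) * (n choose (2 * j - k)))"
    by (rule member_le_sum) auto
  also have "\<dots> = (n + n) choose (2 * j)"
    by (rule vandermonde)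
  finally show ?thesis by (simp add: power2_eq_square mult_2)
qed

lemma choose_two_le:
  assumes "2 \<le> j" "j + 2 \<le> n"
  shows "n choose 2 \<le> n choose j"
proof (cases "2 * j \<le> n")
  case True
  then show ?thesis using binomial_mono[of 2 j n] assms by simp
next
  case False
  then have "n choose 2 \<le> n choose (n - j)"
    using binomial_mono[of 2 "n - j" n] assms by simp
  then show ?thesis using binomial_symmetric[of j n] assms by simp
qed

text \<open>The extreme terms \<open>j = 1\<close> and \<open>j = n - 1\<close> give at most
  \<open>2 / n\<close>; the others are at most \<open>1 / (n choose 2)\<close>, and allowing this
  for all \<open>n - 1\<close> indices adds another \<open>2 / n\<close>.\<close>

lemma sum_inverse_choose_le:
  assumes n: "n \<ge> 2"
  shows "(\<Sum>j=1..n - 1. 1 / real (n choose j)) \<le> 4 / n"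
proof -
  have c2: "real (n choose 2) = real n * (real n - 1) / 2"
    using n by (simp add: choose_two real_of_nat_div of_nat_diff)
  have pos: "real n * (real n - 1) > 0" using n by simp
  have "(\<Sum>j=1..n - 1. 1 / real (n choose j)) \<le>
    (\<Sum>j=1..n - 1. (if j = 1 then 1 / real n else 0) + (if j = n - 1 then 1 / real n else 0)
       + 2 / (real n * (real n - 1)))"
  proof (rule sum_mono)
    fix j assume j: "j \<in> {1..n - 1}"
    consider "j = 1" | "j = n - 1" "j \<noteq> 1" | "2 \<le> j" "j + 2 \<le> n" using j by fastforce
    then show "1 / real (n choose j) \<le> (if j = 1 then 1 / real n else 0) +
        (if j = n - 1 then 1 / real n else 0) + 2 / (real n * (real n - 1))"
    proof cases
      case 1
      then show ?thesis using pos by simp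
    next
      case 2
      then have "n choose j = n" using n binomial_symmetric[of 1 n] by simp
      then show ?thesis using 2 pos by simp
    next
      case 3
      then have "real (n choose 2) \<le> real (n choose j)" using choose_two_le by simp
      then have "1 / real (n choose j) \<le> 1 / real (n choose 2)"
        using c2 pos 3 by (intro divide_left_mono mult_pos_pos) auto
      also have "\<dots> = 2 / (real n * (real n - 1))" by (simp add: c2)
      finally show ?thesis using 3 by auto
    qed
  qed
  also have "\<dots> = 1 / real n + 1 / real n + (real n - 1) * (2 / (real n * (real n - 1)))"
    using n by (simp add: sum.distrib of_nat_diff)
  also have "\<dots> = 4 / real n" using n by (simp add: field_simps)
  finally show ?thesis .
qed

section \<open>Gluings that need not be connected\<close>

definition matchings :: "nat \<Rightarrow> (nat \<Rightarrow> nat) set" where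
  "matchings n = {\<alpha>. \<alpha> permutes {1..2*n} \<and> \<alpha> \<circ> \<alpha> = id \<and> (\<forall>x\<in>{1..2*n}. \<alpha> x \<noteq> x)}"

text \<open>Without transitivity the set is a product, so under its uniform law
  \<open>\<phi>\<close> is uniform for every fixed \<open>\<alpha>\<close>.\<close>

definition gluings :: "nat \<Rightarrow> labeled_map set" where
  "gluings n = matchings n \<times> {\<phi>. \<phi> permutes {1..2*n}}"

lemma labeled_maps_subset_gluings: "labeled_maps n \<subseteq> gluings n"
  by (auto simp: labeled_maps_def gluings_def matchings_def)

text \<open>Take the points reachable from some \<open>x\<close> that fails to reach some
  \<open>y\<close>. A finite set that an injection maps into itself is mapped onto itself.\<close>

lemma invariant_subset:
  assumes "(\<alpha>, \<phi>) \<in> gluings n - labeled_maps n"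
  obtains A where "A \<subseteq> {1..2*n}" "A \<noteq> {}" "A \<noteq> {1..2*n}" "\<alpha> ` A = A" "\<phi> ` A = A"
proof -
  let ?H = "generate (sym_group (2*n)) {\<alpha>, \<phi>}"
  have \<alpha>: "\<alpha> permutes {1..2*n}" and \<phi>: "\<phi> permutes {1..2*n}"
    using assms by (auto simp: gluings_def matchings_def)
  have "\<not> (\<forall>x\<in>{1..2*n}. \<forall>y\<in>{1..2*n}. \<exists>g\<in>?H. g x = y)"
    using assms by (simp add: gluings_def matchings_def labeled_maps_def) blast
  then obtain x y where xy: "x \<in> {1..2*n}" "y \<in> {1..2*n}" "\<And>g. g \<in> ?H \<Longrightarrow> g x \<noteq> y"
    by blast
  have comp: "g \<circ> h \<in> ?H" if "g \<in> ?H" "h \<in> ?H" for g h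
    using generate.eng[OF that] by (simp add: sym_group_mult)
  have id: "id \<in> ?H"
    using generate.one[of "sym_group (2*n)"] by (simp add: sym_group_one id_def)
  have "?H \<subseteq> carrier (sym_group (2*n))"
    by (rule group.generate_incl[OF sym_group_is_group]) (use \<alpha> \<phi> in \<open>auto simp: sym_group_carrier\<close>)
  then have perm: "g permutes {1..2*n}" if "g \<in> ?H" for g
    using that by (auto simp: sym_group_carrier)
  define A where "A = (\<lambda>g. g x) ` ?H"
  have A: "A \<subseteq> {1..2*n}"
    unfolding A_def
  proof (rule image_subsetI)
    fix g assume "g \<in> ?H"
    then show "g x \<in> {1..2*n}" using permutes_in_image[OF perm] xy(1) by blast
  qed
  have invar: "p ` A = A" if p: "p \<in> {\<alpha>, \<phi>}" for p
  proof (rule endo_inj_surj)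
    show "finite A" using A finite_subset by blast
    show "p ` A \<subseteq> A"
    proof -
      have "p (g x) \<in> A" if "g \<in> ?H" for g
        unfolding A_def using comp[OF generate.incl[OF p] that] by (rule image_eqI[rotated]) simp
      then show ?thesis unfolding A_def by blast
    qed
    show "inj_on p A" using p permutes_inj_on[OF \<alpha>] permutes_inj_on[OF \<phi>] by blast
  qed
  show ?thesis
  proof (rule that[OF A])
    show "A \<noteq> {}" using id by (auto simp: A_def)
    have "y \<notin> A" using xy(3) by (auto simp: A_def)
    then show "A \<noteq> {1..2*n}" using xy(2) by blast
  qed (use invar in auto)
qed

text \<open>
  A set invariant under a matching is determined by the lower endpoints of the edges it contains.
\<close>

lemma sum_matching_invariant_le:
  fixes f :: "nat \<Rightarrow> real"
  assumes \<alpha>: "\<alpha> \<in> matchings n" and f: "\<And>k. f k \<ge> 0"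
  shows "(\<Sum>A | A \<subseteq> {1..2*n} \<and> A \<noteq> {} \<and> A \<noteq> {1..2*n} \<and> \<alpha> ` A = A. f (card A)) \<le>
    (\<Sum>j=1..n - 1. real (n choose j) * f (2 * j))"
proof -
  define S where "S = {1..2*n}"
  define T where "T = {x \<in> S. x < \<alpha> x}"
  define AA where "AA = {A. A \<subseteq> S \<and> A \<noteq> {} \<and> A \<noteq> S \<and> \<alpha> ` A = A}"
  have perm: "\<alpha> permutes S" and ne: "\<And>x. x \<in> S \<Longrightarrow> \<alpha> x \<noteq> x"
    using \<alpha> by (auto simp: matchings_def S_def)
  have invol: "\<alpha> (\<alpha> x) = x" for x
    using \<alpha> by (auto simp: matchings_def fun_eq_iff)
  have inS: "\<alpha> x \<in> S \<longleftrightarrow> x \<in> S" for x using perm by (rule permutes_in_image)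
  have inj: "inj_on \<alpha> B" for B using invol by (metis inj_onI)
  have finS: "finite S" by (simp add: S_def)
  have finT: "finite T" using finS by (simp add: T_def)
  have decomp: "A = (A \<inter> T) \<union> \<alpha> ` (A \<inter> T)" if A: "A \<subseteq> S" "\<alpha> ` A = A" for A
  proof
    show "A \<subseteq> (A \<inter> T) \<union> \<alpha> ` (A \<inter> T)"
    proof
      fix x assume x: "x \<in> A"
      then have xS: "x \<in> S" using A by auto
      show "x \<in> (A \<inter> T) \<union> \<alpha> ` (A \<inter> T)"
      proof (cases "x < \<alpha> x")
        case True
        then show ?thesis using x xS by (simp add: T_def)
      next
        case False
        then have "\<alpha> x < \<alpha> (\<alpha> x)" using ne[OF xS] invol by simp
        then have "\<alpha> x \<in> A \<inter> T" using x A xS inS by (auto simp: T_def)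
        then have "\<alpha> (\<alpha> x) \<in> \<alpha> ` (A \<inter> T)" by (rule imageI)
        then show ?thesis using invol by simp
      qed
    qed
  qed (use A in auto)
  have card2: "card A = 2 * card (A \<inter> T)" if A: "A \<subseteq> S" "\<alpha> ` A = A" for A
  proof -
    have "(A \<inter> T) \<inter> \<alpha> ` (A \<inter> T) = {}"
      using invol by (auto simp: T_def)
    then have "card ((A \<inter> T) \<union> \<alpha> ` (A \<inter> T)) = card (A \<inter> T) + card (\<alpha> ` (A \<inter> T))"
      by (intro card_Un_disjoint) (auto simp: finT)
    then show ?thesis using decomp[OF A] card_image[OF inj, of "A \<inter> T"] by simp
  qed
  have cardT: "card T = n"
  proof -
    have "\<alpha> ` S = S" using perm by (rule permutes_image)
    moreover have "S \<inter> T = T" by (auto simp: T_def)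
    ultimately have "card S = 2 * card T" using card2[OF subset_refl] by simp
    then show ?thesis by (simp add: S_def)
  qed
  have "(\<Sum>A\<in>AA. f (card A)) = (\<Sum>A\<in>AA. f (2 * card (A \<inter> T)))"
    using card2 by (intro sum.cong) (auto simp: AA_def)
  also have "\<dots> = (\<Sum>B\<in>(\<lambda>A. A \<inter> T) ` AA. f (2 * card B))"
  proof (rule sum.reindex[symmetric, unfolded comp_def])
    show "inj_on (\<lambda>A. A \<inter> T) AA"
      unfolding AA_def inj_on_def using decomp by (metis (mono_tags, lifting) mem_Collect_eq)
  qed
  also have "\<dots> \<le> (\<Sum>B\<in>{B. B \<subseteq> T \<and> card B \<in> {1..n - 1}}. f (2 * card B))"
  proof (rule sum_mono2)
    show "(\<lambda>A. A \<inter> T) ` AA \<subseteq> {B. B \<subseteq> T \<and> card B \<in> {1..n - 1}}"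
    proof
      fix B assume "B \<in> (\<lambda>A. A \<inter> T) ` AA"
      then obtain A where A: "A \<subseteq> S" "A \<noteq> {}" "A \<noteq> S" "\<alpha> ` A = A" "B = A \<inter> T"
        by (auto simp: AA_def)
      have "card A > 0" using A finS by (meson card_gt_0_iff finite_subset)
      moreover have "card A < card S" using A finS by (simp add: psubset_card_mono psubsetI)
      ultimately show "B \<in> {B. B \<subseteq> T \<and> card B \<in> {1..n - 1}}"
        using card2[OF A(1,4)] A(5) by (auto simp: S_def)
    qed
  qed (auto simp: finT f)
  also have "\<dots> = (\<Sum>j\<in>{1..n - 1}. \<Sum>B | B \<in> {B. B \<subseteq> T \<and> card B \<in> {1..n - 1}} \<and> card B = j. f (2 * card B))"
    by (rule sum.group[symmetric]) (auto simp: finT)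
  also have "\<dots> = (\<Sum>j=1..n - 1. real (n choose j) * f (2 * j))"
  proof (rule sum.cong[OF refl])
    fix j assume j: "j \<in> {1..n - 1}"
    have "(\<Sum>B | B \<in> {B. B \<subseteq> T \<and> card B \<in> {1..n - 1}} \<and> card B = j. f (2 * card B)) =
        (\<Sum>B | B \<subseteq> T \<and> card B = j. f (2 * j))"
      using j by (intro sum.cong) auto
    then show "(\<Sum>B | B \<in> {B. B \<subseteq> T \<and> card B \<in> {1..n - 1}} \<and> card B = j. f (2 * card B)) =
        real (n choose j) * f (2 * j)"
      using n_subsets[OF finT, of j] cardT by simp
  qed
  finally show ?thesis unfolding AA_def S_def .
qed

lemma card_disconnected_le:
  assumes n: "n \<ge> 2" and \<alpha>: "\<alpha> \<in> matchings n"
  shows "real (card {\<phi>. \<phi> permutes {1..2*n} \<and> (\<alpha>, \<phi>) \<notin> labeled_maps n}) \<le> 4 / n * fact (2 * n)"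
proof -
  define AA where "AA = {A. A \<subseteq> {1..2*n} \<and> A \<noteq> {} \<and> A \<noteq> {1..2*n} \<and> \<alpha> ` A = A}"
  define f :: "nat \<Rightarrow> real" where "f k = fact k * fact (2 * n - k)" for k
  have finAA: "finite AA" by (rule finite_subset[of _ "Pow {1..2*n}"]) (auto simp: AA_def)
  have "{\<phi>. \<phi> permutes {1..2*n} \<and> (\<alpha>, \<phi>) \<notin> labeled_maps n} \<subseteq>
      (\<Union>A\<in>AA. {\<phi>. \<phi> permutes {1..2*n} \<and> \<phi> ` A = A})"
  proof safe
    fix \<phi> assume \<phi>: "\<phi> permutes {1..2*n}" "(\<alpha>, \<phi>) \<notin> labeled_maps n"
    then have "(\<alpha>, \<phi>) \<in> gluings n - labeled_maps n" using \<alpha> by (simp add: gluings_def)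
    then obtain A where "A \<subseteq> {1..2*n}" "A \<noteq> {}" "A \<noteq> {1..2*n}" "\<alpha> ` A = A" "\<phi> ` A = A"
      by (rule invariant_subset)
    then show "\<phi> \<in> (\<Union>A\<in>AA. {\<phi>. \<phi> permutes {1..2*n} \<and> \<phi> ` A = A})"
      using \<phi> by (auto simp: AA_def)
  qed
  then have "card {\<phi>. \<phi> permutes {1..2*n} \<and> (\<alpha>, \<phi>) \<notin> labeled_maps n} \<le>
      card (\<Union>A\<in>AA. {\<phi>. \<phi> permutes {1..2*n} \<and> \<phi> ` A = A})"
    by (rule card_mono[rotated])
      (auto intro!: finAA finite_subset[OF _ finite_permutations[of "{1..2*n}"]])
  also have "\<dots> \<le> (\<Sum>A\<in>AA. card {\<phi>. \<phi> permutes {1..2*n} \<and> \<phi> ` A = A})"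
    by (rule card_UN_le[OF finAA])
  also have "\<dots> \<le> (\<Sum>A\<in>AA. fact (card A) * fact (2 * n - card A))"
    using card_permutations_preserving_le[of "{1..2*n}"] by (intro sum_mono) (auto simp: AA_def)
  finally have "real (card {\<phi>. \<phi> permutes {1..2*n} \<and> (\<alpha>, \<phi>) \<notin> labeled_maps n}) \<le>
      real (\<Sum>A\<in>AA. fact (card A) * fact (2 * n - card A))"
    by (simp only: of_nat_le_iff)
  also have "\<dots> = (\<Sum>A\<in>AA. f (card A))"
    by (simp add: f_def)
  also have "\<dots> \<le> (\<Sum>j=1..n - 1. real (n choose j) * f (2 * j))"
    unfolding AA_def by (rule sum_matching_invariant_le[OF \<alpha>]) (simp add: f_def)
  also have "\<dots> \<le> (\<Sum>j=1..n - 1. fact (2 * n) * (1 / real (n choose j)))"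
  proof (rule sum_mono)
    fix j assume j: "j \<in> {1..n - 1}"
    define c where "c = real (n choose j)"
    have "j \<le> n" using j by (auto intro: le_trans[OF _ diff_le_self])
    then have c: "c > 0" by (simp add: c_def zero_less_binomial_iff)
    \<comment> \<open>\<open>f (2 * j)\<close> bounds the number of permutations preserving one set
      of size \<open>2 * j\<close>, a fraction \<open>1 / ((2 * n) choose (2 * j))\<close> of
      all.\<close>
    have "fact (2 * n) = f (2 * j) * real ((2 * n) choose (2 * j))"
      unfolding f_def using j binomial_fact_lemma[of "2 * j" "2 * n"]
      by (metis (no_types, lifting) atLeastAtMost_iff diff_le_self mult_le_mono2 of_nat_fact of_nat_mult order_trans)
    moreover have "c\<^sup>2 \<le> real ((2 * n) choose (2 * j))"
      using choose_square_le[of n j] unfolding c_def by (metis of_nat_le_iff of_nat_power)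
    moreover have "f (2 * j) \<ge> 0" by (simp add: f_def)
    ultimately have "f (2 * j) * c\<^sup>2 \<le> fact (2 * n)" by (simp add: mult_left_mono)
    then show "real (n choose j) * f (2 * j) \<le> fact (2 * n) * (1 / real (n choose j))"
      using c unfolding c_def[symmetric] by (simp add: field_simps power2_eq_square)
  qed
  also have "\<dots> = fact (2 * n) * (\<Sum>j=1..n - 1. 1 / real (n choose j))"
    by (simp only: sum_distrib_left)
  also have "\<dots> \<le> fact (2 * n) * (4 / n)"
    by (intro mult_left_mono sum_inverse_choose_le n) auto
  finally show ?thesis by (simp add: mult.commute)
qed

lemma finite_matchings: "finite (matchings n)"
  by (rule finite_subset[OF _ finite_permutations[of "{1..2*n}"]]) (auto simp: matchings_def)

lemma finite_gluings: "finite (gluings n)"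
  unfolding gluings_def by (intro finite_cartesian_product finite_matchings finite_permutations) simp

lemma card_gluings: "card (gluings n) = card (matchings n) * fact (2 * n)"
  by (simp add: gluings_def card_cartesian_product card_permutations)

lemma card_gluings_diff_labeled_maps_le:
  assumes n: "n \<ge> 2"
  shows "real (card (gluings n - labeled_maps n)) \<le> 4 / n * card (gluings n)"
proof -
  have "gluings n - labeled_maps n =
      (SIGMA \<alpha>:matchings n. {\<phi>. \<phi> permutes {1..2*n} \<and> (\<alpha>, \<phi>) \<notin> labeled_maps n})"
    by (auto simp: gluings_def)
  then have "card (gluings n - labeled_maps n) =
      (\<Sum>\<alpha>\<in>matchings n. card {\<phi>. \<phi> permutes {1..2*n} \<and> (\<alpha>, \<phi>) \<notin> labeled_maps n})"
    by (simp add: card_SigmaI finite_matchings finite_permutations)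
  also have "real \<dots> \<le> (\<Sum>\<alpha>\<in>matchings n. 4 / n * fact (2 * n))"
    unfolding of_nat_sum by (intro sum_mono card_disconnected_le n)
  also have "\<dots> = 4 / n * card (gluings n)"
    by (simp add: card_gluings)
  finally show ?thesis .
qed

text \<open>The terms outside \<open>L\<close> and the change of normalisation each contribute at
  most the proportion of \<open>U - L\<close> in \<open>U\<close>, hence the factor 2.\<close>

lemma norm_average_diff_le:
  fixes f :: "'a \<Rightarrow> complex" and \<delta> :: real
  assumes U: "finite U" and L: "L \<subseteq> U" "L \<noteq> {}" and f: "\<And>x. x \<in> U \<Longrightarrow> norm (f x) \<le> 1"
    and \<delta>: "real (card (U - L)) \<le> \<delta> * card U"
  shows "norm ((\<Sum>x\<in>L. f x) / of_nat (card L) - (\<Sum>x\<in>U. f x) / of_nat (card U)) \<le> 2 * \<delta>"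
proof -
  define l u where "l = real (card L)" and "u = real (card U)"
  have finL: "finite L" using U L finite_subset by blast
  have l: "l > 0" using L finL by (simp add: l_def card_gt_0_iff)
  have lu: "l \<le> u" using U L by (simp add: l_def u_def card_mono)
  have diff: "real (card (U - L)) = u - l"
    using U L finL by (simp add: l_def u_def card_Diff_subset card_mono of_nat_diff)
  have sumU: "(\<Sum>x\<in>U. f x) = (\<Sum>x\<in>L. f x) + (\<Sum>x\<in>U - L. f x)"
    using sum.subset_diff[OF L(1) U, of f] by simp
  have "(\<Sum>x\<in>L. f x) / of_nat (card L) - (\<Sum>x\<in>U. f x) / of_nat (card U) =
      (\<Sum>x\<in>L. f x) * of_real (1 / l - 1 / u) - (\<Sum>x\<in>U - L. f x) * of_real (1 / u)"
    unfolding sumU by (simp add: l_def u_def algebra_simps add_divide_distrib)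
  also have "norm \<dots> \<le> norm (\<Sum>x\<in>L. f x) * (1 / l - 1 / u) + norm (\<Sum>x\<in>U - L. f x) * (1 / u)"
  proof -
    have "1 / l - 1 / u \<ge> 0" using l lu by (simp add: frac_le)
    then show ?thesis
      using l lu by (intro order_trans[OF norm_triangle_ineq4]) (simp add: norm_mult del: of_real_diff of_real_divide)
  qed
  also have "\<dots> \<le> l * (1 / l - 1 / u) + (u - l) * (1 / u)"
  proof (intro add_mono mult_right_mono)
    show "norm (\<Sum>x\<in>L. f x) \<le> l"
      using sum_norm_bound[of L f 1] f L by (auto simp: l_def)
    show "norm (\<Sum>x\<in>U - L. f x) \<le> u - l"
      using sum_norm_bound[of "U - L" f 1] f diff by auto
  qed (use l lu in \<open>auto simp: frac_le\<close>)
  also have "\<dots> = 2 * ((u - l) / u)" using l lu by (simp add: field_simps)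
  also have "\<dots> \<le> 2 * \<delta>"
    using \<delta> diff l lu by (simp add: divide_le_eq u_def)
  finally show ?thesis .
qed

section \<open>A continuity theorem for pairs\<close>

text \<open>The law of \<open>Y\<close> after tilting \<open>M\<close> by \<open>W\<close>. Weights
  will satisfy \<open>1 \<le> W \<le> B\<close>, so the normalising constant is finite and bounded
  away from 0.\<close>

definition weighted_distr :: "'a measure \<Rightarrow> ('a \<Rightarrow> real) \<Rightarrow> ('a \<Rightarrow> real) \<Rightarrow> real measure" where
  "weighted_distr M W Y = distr (density M (\<lambda>\<omega>. ennreal (W \<omega> / (LINT \<omega>|M. W \<omega>)))) borel Y"

lemma (in prob_space) integrable_weight:
  fixes W :: "'a \<Rightarrow> real"
  assumes "W \<in> borel_measurable M" "\<And>\<omega>. 1 \<le> W \<omega>" "\<And>\<omega>. W \<omega> \<le> B"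
  shows "integrable M W"
proof (rule integrable_const_bound[of _ B])
  show "AE \<omega> in M. norm (W \<omega>) \<le> B"
    using assms by (intro AE_I2) (smt (verit) real_norm_def)
qed fact

lemma (in prob_space) expectation_weight_ge_1:
  fixes W :: "'a \<Rightarrow> real"
  assumes "W \<in> borel_measurable M" "\<And>\<omega>. 1 \<le> W \<omega>" "\<And>\<omega>. W \<omega> \<le> B"
  shows "expectation W \<ge> 1"
  using integral_mono[of M "\<lambda>_. 1" W] integrable_weight[OF assms] assms prob_space by simp

lemma (in prob_space) real_distribution_weighted_distr:
  assumes W: "W \<in> borel_measurable M" "\<And>\<omega>. 1 \<le> W \<omega>" "\<And>\<omega>. W \<omega> \<le> B"
    and Y: "Y \<in> borel_measurable M"
  shows "real_distribution (weighted_distr M W Y)"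
proof -
  note [measurable] = W(1) Y
  define c where "c = expectation W"
  have c: "c \<ge> 1" unfolding c_def by (rule expectation_weight_ge_1[OF W])
  have nonneg: "W \<omega> / c \<ge> 0" for \<omega> using W(2)[of \<omega>] c by simp
  have "(\<integral>\<^sup>+\<omega>. ennreal (W \<omega> / c) \<partial>M) = ennreal (LINT \<omega>|M. W \<omega> / c)"
    using integrable_weight[OF W] nonneg by (intro nn_integral_eq_integral) auto
  also have "(LINT \<omega>|M. W \<omega> / c) = 1" using c by (simp add: c_def)
  finally have "prob_space (density M (\<lambda>\<omega>. ennreal (W \<omega> / c)))"
    by (intro prob_spaceI) (simp add: emeasure_density cong: nn_integral_cong)
  then show ?thesis
    unfolding weighted_distr_def c_def[symmetric]
    by (rule prob_space.real_distribution_distr) simp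
qed

lemma (in prob_space) integral_weighted_distr:
  fixes h :: "real \<Rightarrow> 'c :: {banach, second_countable_topology}"
  assumes W: "W \<in> borel_measurable M" "\<And>\<omega>. 1 \<le> W \<omega>" "\<And>\<omega>. W \<omega> \<le> B"
    and Y: "Y \<in> borel_measurable M" and h: "h \<in> borel_measurable borel"
  shows "integral\<^sup>L (weighted_distr M W Y) h = (LINT \<omega>|M. W \<omega> *\<^sub>R h (Y \<omega>)) /\<^sub>R expectation W"
proof -
  note [measurable] = W(1) Y h
  define c where "c = expectation W"
  have c: "c \<ge> 1" unfolding c_def by (rule expectation_weight_ge_1[OF W])
  have nonneg: "W \<omega> / c \<ge> 0" for \<omega> using W(2)[of \<omega>] c by simp
  have "integral\<^sup>L (weighted_distr M W Y) h = integral\<^sup>L (density M (\<lambda>\<omega>. ennreal (W \<omega> / c))) (\<lambda>\<omega>. h (Y \<omega>))"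
    unfolding weighted_distr_def c_def[symmetric] by (rule integral_distr) simp_all
  also have "\<dots> = (LINT \<omega>|M. (W \<omega> / c) *\<^sub>R h (Y \<omega>))"
    by (rule integral_density) (use nonneg in auto)
  also have "\<dots> = (LINT \<omega>|M. inverse c *\<^sub>R (W \<omega> *\<^sub>R h (Y \<omega>)))"
    by (simp add: divide_inverse mult.commute)
  also have "\<dots> = (LINT \<omega>|M. W \<omega> *\<^sub>R h (Y \<omega>)) /\<^sub>R c"
    by (rule integral_scaleR_right)
  finally show ?thesis unfolding c_def .
qed

text \<open>At \<open>t = 0\<close> the hypothesis says that the normalising constants converge.
  Hence so do the characteristic functions of the tilted laws, and after Levy's theorem the
  constants are multiplied back.\<close>

lemma weighted_levy_continuity:
  assumes M: "\<And>n. prob_space (M n)" and P: "prob_space P"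
    and W: "\<And>n. W n \<in> borel_measurable (M n)" "\<And>n \<omega>. 1 \<le> W n \<omega>" "\<And>n \<omega>. W n \<omega> \<le> B"
    and W': "W' \<in> borel_measurable P" "\<And>\<omega>. 1 \<le> W' \<omega>" "\<And>\<omega>. W' \<omega> \<le> B"
    and Y: "\<And>n. Y n \<in> borel_measurable (M n)" "Y' \<in> borel_measurable P"
    and conv: "\<And>t. (\<lambda>n. LINT \<omega>|M n. of_real (W n \<omega>) * iexp (t * Y n \<omega>)) \<longlonglongrightarrow>
      (LINT \<omega>|P. of_real (W' \<omega>) * iexp (t * Y' \<omega>))"
    and g: "continuous_on UNIV g" "\<And>y. \<bar>g y\<bar> \<le> C"
  shows "(\<lambda>n. LINT \<omega>|M n. W n \<omega> * g (Y n \<omega>)) \<longlonglongrightarrow> (LINT \<omega>|P. W' \<omega> * g (Y' \<omega>))"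
proof -
  define \<mu> where "\<mu> n = weighted_distr (M n) (W n) (Y n)" for n
  define \<nu> where "\<nu> = weighted_distr P W' Y'"
  define c where "c n = (LINT \<omega>|M n. W n \<omega>)" for n
  define c' where "c' = (LINT \<omega>|P. W' \<omega>)"
  have c: "c n \<ge> 1" for n unfolding c_def by (rule prob_space.expectation_weight_ge_1[OF M W])
  have c': "c' \<ge> 1" unfolding c'_def by (rule prob_space.expectation_weight_ge_1[OF P W'])
  have cc: "c \<longlonglongrightarrow> c'"
    using tendsto_Re[OF conv[of 0]] by (simp add: c_def[abs_def] c'_def)
  have \<mu>: "real_distribution (\<mu> n)" for n
    unfolding \<mu>_def by (rule prob_space.real_distribution_weighted_distr[OF M W Y(1)])
  have \<nu>: "real_distribution \<nu>"
    unfolding \<nu>_def by (rule prob_space.real_distribution_weighted_distr[OF P W' Y(2)])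
  have int_\<mu>: "integral\<^sup>L (\<mu> n) h = (LINT \<omega>|M n. W n \<omega> *\<^sub>R h (Y n \<omega>)) /\<^sub>R c n"
    if "h \<in> borel_measurable borel" for n and h :: "real \<Rightarrow> 'e :: {banach, second_countable_topology}"
    unfolding \<mu>_def c_def by (rule prob_space.integral_weighted_distr[OF M W Y(1) that])
  have int_\<nu>: "integral\<^sup>L \<nu> h = (LINT \<omega>|P. W' \<omega> *\<^sub>R h (Y' \<omega>)) /\<^sub>R c'"
    if "h \<in> borel_measurable borel" for h :: "real \<Rightarrow> 'e :: {banach, second_countable_topology}"
    unfolding \<nu>_def c'_def by (rule prob_space.integral_weighted_distr[OF P W' Y(2) that])
  have "weak_conv_m \<mu> \<nu>"
  proof (rule levy_continuity[OF \<mu> \<nu>])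
    fix t
    have "char (\<mu> n) t = (LINT \<omega>|M n. of_real (W n \<omega>) * iexp (t * Y n \<omega>)) /\<^sub>R c n" for n
      unfolding char_def by (subst int_\<mu>) (auto simp: scaleR_conv_of_real)
    moreover have "char \<nu> t = (LINT \<omega>|P. of_real (W' \<omega>) * iexp (t * Y' \<omega>)) /\<^sub>R c'"
      unfolding char_def by (subst int_\<nu>) (auto simp: scaleR_conv_of_real)
    ultimately show "(\<lambda>n. char (\<mu> n) t) \<longlonglongrightarrow> char \<nu> t"
      using tendsto_scaleR[OF tendsto_inverse[OF cc] conv[of t]] c' by simp
  qed
  then have "(\<lambda>n. integral\<^sup>L (\<mu> n) g) \<longlonglongrightarrow> integral\<^sup>L \<nu> g"
    by (rule weak_conv_imp_integral_bdd_continuous_conv[OF \<mu> \<nu>])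
      (use g in \<open>auto simp: continuous_on_eq_continuous_at\<close>)
  moreover have "g \<in> borel_measurable borel" using g(1) by (rule borel_measurable_continuous_onI)
  ultimately have "(\<lambda>n. (LINT \<omega>|M n. W n \<omega> * g (Y n \<omega>)) / c n) \<longlonglongrightarrow> (LINT \<omega>|P. W' \<omega> * g (Y' \<omega>)) / c'"
    by (simp add: int_\<mu> int_\<nu> divide_inverse mult.commute)
  from tendsto_mult[OF this cc] show ?thesis
    using c c' by (simp add: order.strict_implies_not_eq[OF less_le_trans[OF zero_less_one], symmetric])
qed

lemma integral_complex_combination:
  fixes u v :: "'a \<Rightarrow> real" and w :: "'a \<Rightarrow> complex"
  assumes "integrable N u" "integrable N v" "integrable N w"
  shows "(LINT \<omega>|N. of_real (u \<omega>) + \<i> * of_real (v \<omega>) + c * w \<omega>) =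
    of_real (LINT \<omega>|N. u \<omega>) + \<i> * of_real (LINT \<omega>|N. v \<omega>) + c * (LINT \<omega>|N. w \<omega>)"
  using assms by simp

section \<open>Joint characteristic functions and products of test functions\<close>

locale joint_char_conv =
  fixes M :: "nat \<Rightarrow> 'b measure" and X Y :: "nat \<Rightarrow> 'b \<Rightarrow> real"
    and P :: "'a measure" and X' Y' :: "'a \<Rightarrow> real"
  assumes M: "\<And>n. prob_space (M n)" and P: "prob_space P"
    and XY [measurable]: "\<And>n. X n \<in> borel_measurable (M n)" "\<And>n. Y n \<in> borel_measurable (M n)"
    and XY' [measurable]: "X' \<in> borel_measurable P" "Y' \<in> borel_measurable P"
    and char_conv: "\<And>s t. (\<lambda>n. LINT \<omega>|M n. iexp (s * X n \<omega> + t * Y n \<omega>)) \<longlonglongrightarrow>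
      (LINT \<omega>|P. iexp (s * X' \<omega> + t * Y' \<omega>))"
begin

lemma integrable_M:
  fixes f :: "'b \<Rightarrow> 'e :: {banach, second_countable_topology}"
  assumes "f \<in> borel_measurable (M n)" "\<And>\<omega>. norm (f \<omega>) \<le> B"
  shows "integrable (M n) f"
  using assms by (intro finite_measure.integrable_const_bound[OF prob_space.finite_measure[OF M], of _ B]) auto

lemma integrable_P:
  fixes f :: "'a \<Rightarrow> 'e :: {banach, second_countable_topology}"
  assumes "f \<in> borel_measurable P" "\<And>\<omega>. norm (f \<omega>) \<le> B"
  shows "integrable P f"
  using assms by (intro finite_measure.integrable_const_bound[OF prob_space.finite_measure[OF P], of _ B]) auto

definition converges :: "(real \<Rightarrow> real \<Rightarrow> real) \<Rightarrow> bool" where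
  "converges h \<longleftrightarrow> (\<lambda>n. LINT \<omega>|M n. h (X n \<omega>) (Y n \<omega>)) \<longlonglongrightarrow> (LINT \<omega>|P. h (X' \<omega>) (Y' \<omega>))"

text \<open>Written with exponentials, the weight turns the transform in \<open>t\<close> into a
  combination of joint characteristic functions at \<open>(0, t)\<close>, \<open>(s, t)\<close> and
  \<open>(- s, t)\<close>. Adding 2 keeps the weight between 1 and 3.\<close>

lemma converges_weighted_cos:
  assumes g: "continuous_on UNIV g" "\<And>y. \<bar>g y\<bar> \<le> C"
  shows "converges (\<lambda>x y. (2 + cos (s * x + r)) * g y)"
  unfolding converges_def
proof (rule weighted_levy_continuity[OF M P _ _ _ _ _ _ _ _ _ g, where B = 3])
  fix t
  have eq: "of_real (2 + cos (s * x + r)) * iexp (t * y) =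
      2 * iexp (0 * x + t * y) + (iexp r / 2) * iexp (s * x + t * y) + (iexp (- r) / 2) * iexp ((- s) * x + t * y)"
    for x y
  proof -
    have "complex_of_real (cos u) = (iexp u + iexp (- u)) / 2" for u
      by (simp add: cos_exp_eq cos_of_real[symmetric])
    then show ?thesis
      by (simp add: exp_add[symmetric] algebra_simps add_divide_distrib)
  qed
  have I: "integrable (M n) (\<lambda>\<omega>. iexp (s * X n \<omega> + t * Y n \<omega>))" for s t n
    by (rule integrable_M[of _ _ 1]) (auto simp del: of_real_add of_real_mult)
  have J: "integrable P (\<lambda>\<omega>. iexp (s * X' \<omega> + t * Y' \<omega>))" for s t
    by (rule integrable_P[of _ 1]) (auto simp del: of_real_add of_real_mult)
  show "(\<lambda>n. LINT \<omega>|M n. of_real (2 + cos (s * X n \<omega> + r)) * iexp (t * Y n \<omega>)) \<longlonglongrightarrow>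
      (LINT \<omega>|P. of_real (2 + cos (s * X' \<omega> + r)) * iexp (t * Y' \<omega>))"
    unfolding eq using I J
    by (simp only: Bochner_Integration.integral_add Bochner_Integration.integrable_add
        integrable_mult_right integral_mult_right_zero)
      (intro tendsto_intros char_conv)
qed (auto intro: order_trans[OF _ cos_ge_minus_one] simp: cos_le_one add.commute, (smt (verit) cos_ge_minus_one cos_le_one)+)

lemma converges_y:
  assumes g: "continuous_on UNIV g" "\<And>y. \<bar>g y\<bar> \<le> C"
  shows "converges (\<lambda>x y. g y)"
proof -
  have "(\<lambda>n. LINT \<omega>|M n. 1 * g (Y n \<omega>)) \<longlonglongrightarrow> (LINT \<omega>|P. 1 * g (Y' \<omega>))"
  proof (rule weighted_levy_continuity[where B = 1, OF M P _ _ _ _ _ _ _ _ _ g])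
    fix t
    show "(\<lambda>n. LINT \<omega>|M n. of_real 1 * iexp (t * Y n \<omega>)) \<longlonglongrightarrow> (LINT \<omega>|P. of_real 1 * iexp (t * Y' \<omega>))"
      using char_conv[of 0 t] by (simp only: of_real_1 mult_1 mult_zero_left add_0_left add_0_right)
  qed auto
  then show ?thesis by (simp add: converges_def)
qed

lemma converges_x:
  assumes g: "continuous_on UNIV g" "\<And>y. \<bar>g y\<bar> \<le> C"
  shows "converges (\<lambda>x y. g x)"
proof -
  have "(\<lambda>n. LINT \<omega>|M n. 1 * g (X n \<omega>)) \<longlonglongrightarrow> (LINT \<omega>|P. 1 * g (X' \<omega>))"
  proof (rule weighted_levy_continuity[where B = 1, OF M P _ _ _ _ _ _ _ _ _ g])
    fix t
    show "(\<lambda>n. LINT \<omega>|M n. of_real 1 * iexp (t * X n \<omega>)) \<longlonglongrightarrow> (LINT \<omega>|P. of_real 1 * iexp (t * X' \<omega>))"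
      using char_conv[of t 0] by (simp only: of_real_1 mult_1 mult_zero_left add_0_left add_0_right)
  qed auto
  then show ?thesis by (simp add: converges_def)
qed

lemma converges_cos:
  assumes g: "continuous_on UNIV g" "\<And>y. \<bar>g y\<bar> \<le> C"
  shows "converges (\<lambda>x y. cos (s * x + r) * g y)"
proof -
  have [measurable]: "g \<in> borel_measurable borel" using g(1) by (rule borel_measurable_continuous_onI)
  have b: "\<bar>cos u * g y\<bar> \<le> C" for u y
    using mult_mono[of "\<bar>cos u\<bar>" 1 "\<bar>g y\<bar>" C] g(2)[of y] by (simp add: abs_mult)
  have "integrable (M n) (\<lambda>\<omega>. cos (s * X n \<omega> + r) * g (Y n \<omega>))" "integrable (M n) (\<lambda>\<omega>. g (Y n \<omega>))" for n
    by (rule integrable_M[of _ _ C]; use b g in simp)+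
  moreover have "integrable P (\<lambda>\<omega>. cos (s * X' \<omega> + r) * g (Y' \<omega>))" "integrable P (\<lambda>\<omega>. g (Y' \<omega>))"
    by (rule integrable_P[of _ C]; use b g in simp)+
  ultimately show ?thesis
    using tendsto_diff[OF converges_weighted_cos[OF g, of s r, unfolded converges_def]
        tendsto_mult[OF tendsto_const[of 2] converges_y[OF g, unfolded converges_def]]]
    by (simp add: converges_def distrib_right)
qed

text \<open>The roles are exchanged: \<open>g\<close>, shifted by \<open>C + 1\<close> to be at
  least 1, becomes the weight, and \<open>f\<close> is tested against the law of \<open>X\<close>.
  The transform needed is supplied by \<open>converges_cos\<close>.\<close>

lemma converges_product:
  assumes f: "continuous_on UNIV f" "\<And>x. \<bar>f x\<bar> \<le> B" and g: "continuous_on UNIV g" "\<And>y. \<bar>g y\<bar> \<le> C"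
  shows "converges (\<lambda>x y. f x * g y)"
proof -
  have [measurable]: "g \<in> borel_measurable borel" using g(1) by (rule borel_measurable_continuous_onI)
  have [measurable]: "f \<in> borel_measurable borel" using f(1) by (rule borel_measurable_continuous_onI)
  have bc: "\<bar>cos u * g y\<bar> \<le> C" for u y
    using mult_mono[of "\<bar>cos u\<bar>" 1 "\<bar>g y\<bar>" C] g(2)[of y] by (simp add: abs_mult)
  have bf: "\<bar>f x * g y\<bar> \<le> B * C" for x y
    using mult_mono[of "\<bar>f x\<bar>" B "\<bar>g y\<bar>" C] f(2)[of x] g(2)[of y] by (simp add: abs_mult)
  have I: "integrable (M n) (\<lambda>\<omega>. cos (s * X n \<omega> + r) * g (Y n \<omega>))" for n s r
    by (rule integrable_M[of _ _ C]; use bc in simp)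
  have J: "integrable P (\<lambda>\<omega>. cos (s * X' \<omega> + r) * g (Y' \<omega>))" for s r
    by (rule integrable_P[of _ C]; use bc in simp)
  have I': "integrable (M n) (\<lambda>\<omega>. iexp (s * X n \<omega>))" for n s
    by (rule integrable_M[of _ _ 1]) (auto simp del: of_real_mult)
  have J': "integrable P (\<lambda>\<omega>. iexp (s * X' \<omega>))" for s
    by (rule integrable_P[of _ 1]) (auto simp del: of_real_mult)
  \<comment> \<open>A named zero gives the real part the same shape \<open>cos (s * x + r)\<close>
    as the imaginary part, a sine written with phase \<open>- (pi / 2)\<close>.\<close>
  obtain r0 :: real where r0: "r0 = 0" by simp
  have eq: "of_real (g y + (C + 1)) * iexp (s * x) =
      of_real (cos (s * x + r0) * g y) + \<i> * of_real (cos (s * x + (- (pi / 2))) * g y) + of_real (C + 1) * iexp (s * x)"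
    for s x y
  proof -
    have "iexp u = of_real (cos u) + \<i> * of_real (cos (u + (- (pi / 2))))" for u
      by (simp add: complex_eq_iff Re_exp Im_exp cos_diff)
    from this[of "s * x"] show ?thesis by (simp add: r0 algebra_simps)
  qed
  have gb: "1 \<le> g y + (C + 1)" "g y + (C + 1) \<le> 2 * C + 1" for y
    using g(2)[of y] by auto
  have lim: "(\<lambda>n. LINT \<omega>|M n. (g (Y n \<omega>) + (C + 1)) * f (X n \<omega>)) \<longlonglongrightarrow>
      (LINT \<omega>|P. (g (Y' \<omega>) + (C + 1)) * f (X' \<omega>))"
  proof (rule weighted_levy_continuity[OF M P _ _ _ _ _ _ _ _ _ f, where B = "2 * C + 1"])
    fix s
    show "(\<lambda>n. LINT \<omega>|M n. of_real (g (Y n \<omega>) + (C + 1)) * iexp (s * X n \<omega>)) \<longlonglongrightarrow>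
      (LINT \<omega>|P. of_real (g (Y' \<omega>) + (C + 1)) * iexp (s * X' \<omega>))"
      unfolding eq integral_complex_combination[OF I I I'] integral_complex_combination[OF J J J']
      by (intro tendsto_add tendsto_mult tendsto_const tendsto_of_real
          converges_cos[OF g, unfolded converges_def] char_conv[of s 0, unfolded mult_zero_left add_0_right])
  qed (simp_all only: gb, measurable)
  have split: "(g y + (C + 1)) * f x = f x * g y + (C + 1) * f x" for x y
    by (simp add: algebra_simps)
  have "integrable (M n) (\<lambda>\<omega>. f (X n \<omega>) * g (Y n \<omega>))" "integrable (M n) (\<lambda>\<omega>. f (X n \<omega>))" for n
    by (rule integrable_M[of _ _ "B * C"]; use bf in simp) (rule integrable_M[of _ _ B]; use f in simp)
  then have M_eq: "(LINT \<omega>|M n. (g (Y n \<omega>) + (C + 1)) * f (X n \<omega>)) =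
      (LINT \<omega>|M n. f (X n \<omega>) * g (Y n \<omega>)) + (C + 1) * (LINT \<omega>|M n. f (X n \<omega>))" for n
    unfolding split by simp
  have "integrable P (\<lambda>\<omega>. f (X' \<omega>) * g (Y' \<omega>))" "integrable P (\<lambda>\<omega>. f (X' \<omega>))"
    by (rule integrable_P[of _ "B * C"]; use bf in simp) (rule integrable_P[of _ B]; use f in simp)
  then have P_eq: "(LINT \<omega>|P. (g (Y' \<omega>) + (C + 1)) * f (X' \<omega>)) =
      (LINT \<omega>|P. f (X' \<omega>) * g (Y' \<omega>)) + (C + 1) * (LINT \<omega>|P. f (X' \<omega>))"
    unfolding split by simp
  have "(\<lambda>n. (C + 1) * (LINT \<omega>|M n. f (X n \<omega>))) \<longlonglongrightarrow> (C + 1) * (LINT \<omega>|P. f (X' \<omega>))"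
    using converges_x[OF f] unfolding converges_def by (intro tendsto_intros)
  from tendsto_diff[OF lim this] show ?thesis
    by (simp add: converges_def M_eq P_eq)
qed

end

text \<open>Convergence extends to this class by linearity. It is also closed under multiplication,
  hence contains all polynomials in bounded continuous functions of the single coordinates.\<close>

inductive product_sum :: "(real \<Rightarrow> real \<Rightarrow> real) \<Rightarrow> bool" where
  product: "continuous_on UNIV f \<Longrightarrow> (\<And>x. \<bar>f x\<bar> \<le> B) \<Longrightarrow> continuous_on UNIV g \<Longrightarrow> (\<And>y. \<bar>g y\<bar> \<le> C)
    \<Longrightarrow> product_sum (\<lambda>x y. f x * g y)"
| add: "product_sum h \<Longrightarrow> product_sum k \<Longrightarrow> product_sum (\<lambda>x y. h x y + k x y)"

lemma product_sum_fst: "continuous_on UNIV f \<Longrightarrow> (\<And>x. \<bar>f x\<bar> \<le> B) \<Longrightarrow> product_sum (\<lambda>x y. f x)"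
  using product_sum.product[of f B "\<lambda>_. 1" 1] by simp

lemma product_sum_snd: "continuous_on UNIV g \<Longrightarrow> (\<And>y. \<bar>g y\<bar> \<le> C) \<Longrightarrow> product_sum (\<lambda>x y. g y)"
  using product_sum.product[of "\<lambda>_. 1" 1 g C] by simp

lemma product_sum_product_mult:
  assumes "product_sum k"
    and f: "continuous_on UNIV f" "\<And>x. \<bar>f x\<bar> \<le> B" and g: "continuous_on UNIV g" "\<And>y. \<bar>g y\<bar> \<le> C"
  shows "product_sum (\<lambda>x y. (f x * g y) * k x y)"
  using assms(1)
proof induction
  case (product f' B' g' C')
  have "product_sum (\<lambda>x y. (f x * f' x) * (g y * g' y))"
  proof (rule product_sum.product)
    show "\<bar>f x * f' x\<bar> \<le> B * B'" "\<bar>g x * g' x\<bar> \<le> C * C'" for x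
      using f(2)[of x] g(2)[of x] product(2)[of x] product(4)[of x]
      by (auto simp: abs_mult intro!: mult_mono order_trans[OF abs_ge_zero])
  qed (intro continuous_intros f g product)+
  then show ?case by (simp add: ac_simps)
next
  case (add h k)
  then have "product_sum (\<lambda>x y. (f x * g y) * h x y + (f x * g y) * k x y)"
    by (intro product_sum.add)
  then show ?case by (simp add: distrib_left)
qed

lemma product_sum_mult:
  assumes "product_sum h" "product_sum k"
  shows "product_sum (\<lambda>x y. h x y * k x y)"
  using assms(1)
proof induction
  case (product f B g C)
  then show ?case by (intro product_sum_product_mult[OF assms(2)])
next
  case (add h h')
  then have "product_sum (\<lambda>x y. h x y * k x y + h' x y * k x y)"
    by (intro product_sum.add)
  then show ?case by (simp add: distrib_right)
qed

section \<open>Truncation to a large square\<close>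

definition clamp_to :: "real \<Rightarrow> real \<Rightarrow> real" where
  "clamp_to K x = max (- K) (min K x)"

lemma continuous_on_clamp_to: "continuous_on S (clamp_to K)"
  unfolding clamp_to_def by (intro continuous_intros)

lemma abs_clamp_to_le: "K \<ge> 0 \<Longrightarrow> \<bar>clamp_to K x\<bar> \<le> K"
  by (auto simp: clamp_to_def)

lemma clamp_to_eq: "\<bar>x\<bar> \<le> K \<Longrightarrow> clamp_to K x = x"
  by (auto simp: clamp_to_def)

lemma product_sum_polynomial_clamp:
  fixes p :: "real \<times> real \<Rightarrow> real"
  assumes "real_polynomial_function p" and K: "K \<ge> 0"
  shows "product_sum (\<lambda>x y. p (clamp_to K x, clamp_to K y))"
  using assms(1)
proof induction
  case (linear f)
  then interpret bounded_linear f .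
  have "f (x, y) = f (1, 0) * x + f (0, 1) * y" for x y
    using add[of "x *\<^sub>R (1, 0)" "y *\<^sub>R (0, 1)"] scale[of x "(1, 0)"] scale[of y "(0, 1)"]
    by (simp add: mult.commute)
  then obtain a b where eq: "\<And>x y. f (x, y) = a * x + b * y" by blast
  have "\<bar>c * clamp_to K x\<bar> \<le> \<bar>c\<bar> * K" for c x
    using abs_clamp_to_le[OF K, of x] by (simp add: abs_mult mult_left_mono)
  then show ?case
    unfolding eq by (intro product_sum.add product_sum_fst product_sum_snd)
      (auto intro!: continuous_intros continuous_on_clamp_to)
next
  case (const c)
  show ?case by (rule product_sum_fst[of _ "\<bar>c\<bar>"]) auto
qed (simp_all only: product_sum.add product_sum_mult)

text \<open>A continuous stand-in for the indicator of large \<open>\<bar>x\<bar>\<close>. Being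
  continuous it is itself a test function, so tightness needs no separate argument.\<close>

definition tail :: "real \<Rightarrow> real \<Rightarrow> real" where
  "tail K x = min 1 (max 0 (\<bar>x\<bar> - K))"

lemma continuous_on_tail: "continuous_on S (tail K)"
  unfolding tail_def by (intro continuous_intros)

lemma tail_bounds: "0 \<le> tail K x" "tail K x \<le> 1" "\<bar>tail K x\<bar> \<le> 1"
  by (auto simp: tail_def)

lemma tail_eq_1: "\<bar>x\<bar> > K + 1 \<Longrightarrow> tail K x = 1"
  by (auto simp: tail_def)

lemma (in prob_space) expectation_tail_tendsto:
  assumes [measurable]: "Z \<in> borel_measurable M"
  shows "(\<lambda>k. expectation (\<lambda>\<omega>. tail (real k) (Z \<omega>))) \<longlonglongrightarrow> 0"
proof -
  have [measurable]: "tail K \<in> borel_measurable borel" for K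
    by (rule borel_measurable_continuous_onI[OF continuous_on_tail])
  have "(\<lambda>k. expectation (\<lambda>\<omega>. tail (real k) (Z \<omega>))) \<longlonglongrightarrow> expectation (\<lambda>\<omega>. 0)"
  proof (rule integral_dominated_convergence[where w = "\<lambda>_. 1"])
    show "AE \<omega> in M. (\<lambda>k. tail (real k) (Z \<omega>)) \<longlonglongrightarrow> 0"
    proof (intro AE_I2 tendsto_eventually)
      fix \<omega>
      show "\<forall>\<^sub>F k in sequentially. tail (real k) (Z \<omega>) = 0"
        using eventually_ge_at_top[of "nat \<lceil>\<bar>Z \<omega>\<bar>\<rceil>"]
      proof eventually_elim
        case (elim k)
        then have "\<bar>Z \<omega>\<bar> \<le> real k" by linarith
        then show ?case by (simp add: tail_def)
      qed
    qed
  qed (use tail_bounds in auto)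
  then show ?thesis by simp
qed

context joint_char_conv
begin

lemma converges_product_sum:
  assumes "product_sum h"
  shows "converges h \<and> (\<forall>n. integrable (M n) (\<lambda>\<omega>. h (X n \<omega>) (Y n \<omega>))) \<and>
    integrable P (\<lambda>\<omega>. h (X' \<omega>) (Y' \<omega>))"
  using assms
proof induction
  case (product f B g C)
  note [measurable] = borel_measurable_continuous_onI[OF product(1)] borel_measurable_continuous_onI[OF product(3)]
  have b: "norm (f x * g y) \<le> B * C" for x y
    using product(2)[of x] product(4)[of y]
    by (auto simp: abs_mult intro!: mult_mono order_trans[OF abs_ge_zero])
  have "integrable (M n) (\<lambda>\<omega>. f (X n \<omega>) * g (Y n \<omega>))" for n
    by (rule integrable_M[OF _ b]) measurable
  moreover have "integrable P (\<lambda>\<omega>. f (X' \<omega>) * g (Y' \<omega>))"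
    by (rule integrable_P[OF _ b]) measurable
  ultimately show ?case using converges_product[OF product] by blast
next
  case (add h k)
  then show ?case unfolding converges_def by (auto intro: tendsto_add)
qed

text \<open>
  On a large square the limit function is approximated by a polynomial (Stone--Weierstrass);
  clamping the coordinates makes it a bounded sum of products, and \<^const>\<open>tail\<close> pays for the
  error off the square.
\<close>

lemma tendsto_integral_uniform_on_compacts:
  fixes h :: "nat \<Rightarrow> real \<times> real \<Rightarrow> real" and h' :: "real \<times> real \<Rightarrow> real"
  assumes h: "\<And>n. continuous_on UNIV (h n)" "\<And>n z. \<bar>h n z\<bar> \<le> B"
    and h': "continuous_on UNIV h'" "\<And>z. \<bar>h' z\<bar> \<le> B"
    and unif: "\<And>K. uniform_limit ({-K..K} \<times> {-K..K}) h h' sequentially"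
  shows "(\<lambda>n. LINT \<omega>|M n. h n (X n \<omega>, Y n \<omega>)) \<longlonglongrightarrow> (LINT \<omega>|P. h' (X' \<omega>, Y' \<omega>))"
proof (rule tendstoI)
  fix \<epsilon> :: real assume \<epsilon>: "\<epsilon> > 0"
  have B: "B \<ge> 0" using h'(2) abs_ge_zero order_trans by blast
  note [measurable] = borel_measurable_continuous_onI[OF h(1)] borel_measurable_continuous_onI[OF h'(1)]
  \<comment> \<open>The limit and the \<open>n\<close>-th integral are each replaced by that of
    \<open>q\<close> at a cost of \<open>2 * e + 2 * B * d\<close>, and the two integrals of
    \<open>q\<close> differ by less than \<open>\<epsilon> / 16\<close>. The \<open>B + 1\<close> in
    \<open>d\<close> covers \<open>B = 0\<close>.\<close>
  define e where "e = \<epsilon> / 16"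
  define d where "d = \<epsilon> / (8 * (B + 1))"
  have e: "e > 0" and d: "d > 0" using \<epsilon> B by (auto simp: e_def d_def)
  have "4 * B * d \<le> \<epsilon> / 2"
    using \<epsilon> B by (simp add: d_def field_simps)
  then have total: "4 * e + 4 * B * d \<le> 3 / 4 * \<epsilon>" using e by (simp add: e_def)
  have "(\<lambda>k. (LINT \<omega>|P. tail (real k) (X' \<omega>)) + (LINT \<omega>|P. tail (real k) (Y' \<omega>))) \<longlonglongrightarrow> 0 + 0"
    by (intro tendsto_add prob_space.expectation_tail_tendsto[OF P] XY')
  then have "\<forall>\<^sub>F k in sequentially.
      (LINT \<omega>|P. tail (real k) (X' \<omega>)) + (LINT \<omega>|P. tail (real k) (Y' \<omega>)) < d"
    using d by (intro order_tendstoD(2)[of _ 0]) auto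
  then obtain k where k: "(LINT \<omega>|P. tail (real k) (X' \<omega>)) + (LINT \<omega>|P. tail (real k) (Y' \<omega>)) < d"
    by (auto simp: eventually_sequentially)
  \<comment> \<open>One more than \<open>k\<close>, because \<open>tail (real k)\<close> reaches 1
    only there.\<close>
  define K where "K = real k + 1"
  have K: "K \<ge> 0" by (simp add: K_def)
  define S where "S = {-K..K} \<times> {-K..K}"
  have S: "z \<in> S \<longleftrightarrow> \<bar>fst z\<bar> \<le> K \<and> \<bar>snd z\<bar> \<le> K" for z
    by (cases z) (auto simp: S_def)
  have "compact S" unfolding S_def by (intro compact_Times compact_Icc)
  then obtain p where p: "real_polynomial_function p" "\<And>z. z \<in> S \<Longrightarrow> \<bar>h' z - p z\<bar> < e"
    using Stone_Weierstrass_real_polynomial_function[of S h' e] e h'(1) continuous_on_subset by blast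
  define q where "q x y = p (clamp_to K x, clamp_to K y)" for x y
  define T where "T x y = tail (real k) x + tail (real k) y" for x y
  have q: "product_sum q"
    unfolding q_def using product_sum_polynomial_clamp[OF p(1) K] .
  have T: "product_sum T"
    unfolding T_def
    by (intro product_sum.add product_sum_fst[of _ 1] product_sum_snd[of _ 1] continuous_on_tail tail_bounds)
  note qT = converges_product_sum[OF q] converges_product_sum[OF T]
  have T0: "T x y \<ge> 0" for x y by (simp add: T_def tail_bounds)
  have T1: "T x y \<ge> 1" if "(x, y) \<notin> S" for x y
    using that tail_eq_1[of "real k" x] tail_eq_1[of "real k" y] tail_bounds[of "real k" x] tail_bounds[of "real k" y]
    by (auto simp: T_def S K_def)
  \<comment> \<open>Clamping moves every point into \<open>S\<close>, so the approximation on
    \<open>S\<close> bounds \<open>q\<close> everywhere.\<close>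
  have q_bound: "\<bar>q x y\<bar> \<le> B + e" for x y
  proof -
    have "(clamp_to K x, clamp_to K y) \<in> S" using abs_clamp_to_le[OF K] by (simp add: S)
    from p(2)[OF this] h'(2)[of "(clamp_to K x, clamp_to K y)"] show ?thesis
      by (simp add: q_def)
  qed
  have q_eq: "q x y = p (x, y)" if "(x, y) \<in> S" for x y
    using that by (simp add: q_def S clamp_to_eq)
  have bound: "\<bar>g (x, y) - q x y\<bar> \<le> 2 * e + 2 * B * T x y"
    if g: "\<And>z. \<bar>g z\<bar> \<le> B" "\<And>z. z \<in> S \<Longrightarrow> \<bar>g z - h' z\<bar> \<le> e" for g x y
  proof (cases "(x, y) \<in> S")
    case True
    have "\<bar>g (x, y) - q x y\<bar> \<le> 2 * e" using g(2)[OF True] p(2)[OF True] q_eq[OF True] by linarith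
    then show ?thesis using T0[of x y] B by (smt (verit) mult_nonneg_nonneg)
  next
    case False
    have "\<bar>g (x, y) - q x y\<bar> \<le> 2 * B + e" using g(1)[of "(x, y)"] q_bound[of x y] by linarith
    also have "2 * B \<le> 2 * B * T x y" using T1[OF False] B by (simp add: mult_le_cancel_left1)
    finally show ?thesis using e by simp
  qed
  have P_bound: "\<bar>(LINT \<omega>|P. h' (X' \<omega>, Y' \<omega>)) - (LINT \<omega>|P. q (X' \<omega>) (Y' \<omega>))\<bar> \<le>
      2 * e + 2 * B * (LINT \<omega>|P. T (X' \<omega>) (Y' \<omega>))"
  proof -
    interpret prob_space P by (rule P)
    have int: "integrable P (\<lambda>\<omega>. h' (X' \<omega>, Y' \<omega>))" by (rule integrable_P[of _ B]) (use h' in auto)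
    have "\<bar>LINT \<omega>|P. h' (X' \<omega>, Y' \<omega>) - q (X' \<omega>) (Y' \<omega>)\<bar> \<le> (LINT \<omega>|P. 2 * e + 2 * B * T (X' \<omega>) (Y' \<omega>))"
      using bound[of h'] h'(2) e qT int by (intro order_trans[OF integral_abs_bound integral_mono]) auto
    then show ?thesis using qT int prob_space by simp
  qed
  have "\<forall>\<^sub>F n in sequentially. \<forall>z\<in>S. dist (h n z) (h' z) < e"
    using unif[of K] e unfolding S_def by (rule uniform_limitD)
  then have M_bound: "\<forall>\<^sub>F n in sequentially. \<bar>(LINT \<omega>|M n. h n (X n \<omega>, Y n \<omega>)) - (LINT \<omega>|M n. q (X n \<omega>) (Y n \<omega>))\<bar> \<le>
      2 * e + 2 * B * (LINT \<omega>|M n. T (X n \<omega>) (Y n \<omega>))"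
  proof eventually_elim
    case (elim n)
    interpret prob_space "M n" by (rule M)
    have int: "integrable (M n) (\<lambda>\<omega>. h n (X n \<omega>, Y n \<omega>))" by (rule integrable_M[of _ _ B]) (use h in auto)
    have "\<bar>LINT \<omega>|M n. h n (X n \<omega>, Y n \<omega>) - q (X n \<omega>) (Y n \<omega>)\<bar> \<le> (LINT \<omega>|M n. 2 * e + 2 * B * T (X n \<omega>) (Y n \<omega>))"
      using bound[of "h n"] h(2) elim qT int
      by (intro order_trans[OF integral_abs_bound integral_mono]) (auto simp: dist_real_def less_imp_le)
    then show ?case using qT int prob_space by simp
  qed
  have P_T: "(LINT \<omega>|P. T (X' \<omega>) (Y' \<omega>)) < d"
  proof -
    have "integrable P (\<lambda>\<omega>. tail (real k) (X' \<omega>))" "integrable P (\<lambda>\<omega>. tail (real k) (Y' \<omega>))"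
      using converges_product_sum[OF product_sum_fst[of "tail (real k)" 1]]
        converges_product_sum[OF product_sum_snd[of "tail (real k)" 1]] continuous_on_tail tail_bounds by auto
    then show ?thesis using k by (simp add: T_def)
  qed
  \<comment> \<open>The choice of \<open>k\<close> controls the limit law only; convergence for
    \<open>T\<close> passes the bound on to all large \<open>n\<close>.\<close>
  then have M_T: "\<forall>\<^sub>F n in sequentially. (LINT \<omega>|M n. T (X n \<omega>) (Y n \<omega>)) < d"
    using qT by (intro order_tendstoD(2)) (auto simp: converges_def)
  have M_q: "\<forall>\<^sub>F n in sequentially. dist (LINT \<omega>|M n. q (X n \<omega>) (Y n \<omega>)) (LINT \<omega>|P. q (X' \<omega>) (Y' \<omega>)) < \<epsilon> / 16"
    using qT \<epsilon> by (intro tendstoD) (auto simp: converges_def)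
  show "\<forall>\<^sub>F n in sequentially. dist (LINT \<omega>|M n. h n (X n \<omega>, Y n \<omega>)) (LINT \<omega>|P. h' (X' \<omega>, Y' \<omega>)) < \<epsilon>"
    using M_bound M_T M_q
  proof eventually_elim
    case (elim n)
    have "2 * B * (LINT \<omega>|M n. T (X n \<omega>) (Y n \<omega>)) \<le> 2 * B * d"
      "2 * B * (LINT \<omega>|P. T (X' \<omega>) (Y' \<omega>)) \<le> 2 * B * d"
      using elim P_T B by (auto intro!: mult_left_mono)
    then show ?case using elim P_bound total e unfolding dist_real_def e_def by linarith
  qed
qed

end

section \<open>Faces, vertices and genus of a uniform map\<close>

text \<open>The bound for derangements is the same for every matching, so averaging over
  \<open>\<alpha>\<close> preserves it.\<close>

lemma norm_average_gluings_le:
  fixes a b :: complex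
  assumes a: "norm a = 1" and b: "norm b = 1" and n: "n \<ge> 1"
  shows "norm ((\<Sum>m\<in>gluings n. a ^ card (faces n m) * b ^ card (vertices n m)) / card (gluings n)
      - ewens_prod (a + b - 2) (2 * n)) \<le> norm (a * b - 1) + 4 * (norm (a - 1) * norm (b - 1))"
proof -
  define S where "S = {1..2 * n}"
  define N where "N = card (matchings n)"
  define \<pi> where "\<pi> = ewens_prod (a + b - 2) (2 * n)"
  have "gluings n \<noteq> {}" using labeled_maps_nonempty labeled_maps_subset_gluings by blast
  then have "matchings n \<noteq> {}" by (auto simp: gluings_def)
  then have N: "N > 0" by (simp add: N_def card_gt_0_iff finite_matchings)
  have "(\<Sum>m\<in>gluings n. a ^ card (faces n m) * b ^ card (vertices n m)) =
      (\<Sum>\<alpha>\<in>matchings n. cycle_sum a b S \<alpha>)"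
    unfolding gluings_def cycle_sum_def S_def
    by (simp add: sum.cartesian_product' faces_def vertices_def)
  then have "(\<Sum>m\<in>gluings n. a ^ card (faces n m) * b ^ card (vertices n m)) / card (gluings n) - \<pi> =
      (\<Sum>\<alpha>\<in>matchings n. cycle_sum a b S \<alpha> / fact (2 * n) - \<pi>) / of_nat N"
    using N by (simp add: card_gluings N_def[symmetric] sum_subtractf sum_divide_distrib[symmetric]
        diff_divide_distrib mult.commute)
  also have "norm \<dots> = norm (\<Sum>\<alpha>\<in>matchings n. cycle_sum a b S \<alpha> / fact (2 * n) - \<pi>) / N"
    by (simp add: norm_divide)
  also have "\<dots> \<le> (N * (norm (a * b - 1) + 4 * (norm (a - 1) * norm (b - 1)))) / N"
  proof (intro divide_right_mono)
    have "norm (cycle_sum a b S \<alpha> / fact (2 * n) - \<pi>) \<le> norm (a * b - 1) + 4 * (norm (a - 1) * norm (b - 1))"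
      if "\<alpha> \<in> matchings n" for \<alpha>
      using norm_cycle_sum_derangement_approx[OF a b, of S \<alpha>] that n
      by (auto simp: S_def \<pi>_def matchings_def)
    then show "norm (\<Sum>\<alpha>\<in>matchings n. cycle_sum a b S \<alpha> / fact (2 * n) - \<pi>) \<le>
        N * (norm (a * b - 1) + 4 * (norm (a - 1) * norm (b - 1)))"
      unfolding N_def by (rule sum_norm_bound)
  qed simp
  also have "\<dots> = norm (a * b - 1) + 4 * (norm (a - 1) * norm (b - 1))" using N by simp
  finally show ?thesis by (simp add: \<pi>_def)
qed

lemma integral_uniform_map:
  fixes f :: "labeled_map \<Rightarrow> complex"
  shows "(LINT m|measure_pmf (uniform_map n). f m) = (\<Sum>m\<in>labeled_maps n. f m) / card (labeled_maps n)"
proof -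
  have "(LINT m|measure_pmf (uniform_map n). f m) = (\<Sum>m\<in>labeled_maps n. pmf (uniform_map n) m *\<^sub>R f m)"
    by (rule integral_measure_pmf)
      (auto simp: uniform_map_def finite_labeled_maps labeled_maps_nonempty)
  also have "\<dots> = (\<Sum>m\<in>labeled_maps n. f m / card (labeled_maps n))"
    by (rule sum.cong) (auto simp: uniform_map_def finite_labeled_maps labeled_maps_nonempty
        scaleR_conv_of_real divide_inverse mult.commute)
  finally show ?thesis by (simp only: sum_divide_distrib)
qed

lemma char_vertices_faces:
  "(\<lambda>n. LINT m|measure_pmf (uniform_map n).
      iexp (s * ((real (card (vertices n m)) - ln (real n)) / sqrt (ln (real n))) +
            t * ((real (card (faces n m)) - ln (real n)) / sqrt (ln (real n)))))
   \<longlonglongrightarrow> of_real (exp (- s\<^sup>2 / 2) * exp (- t\<^sup>2 / 2))"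
proof -
  define L where "L n = ln (real n)" for n
  define a where "a n = iexp (t / sqrt (L n))" for n
  define b where "b n = iexp (s / sqrt (L n))" for n
  define c where "c n = iexp (- ((s + t) * sqrt (L n)))" for n
  define f where "f n m = a n ^ card (faces n m) * b n ^ card (vertices n m)" for n m
  \<comment> \<open>\<open>8 / n\<close> is twice the bound \<open>4 / n\<close> on the proportion
    of disconnected gluings. The rest is the error of the generating function and vanishes since
    \<open>a n\<close> and \<open>b n\<close> tend to 1.\<close>
  define err where "err n = 8 / real n + (norm (a n * b n - 1) + 4 * (norm (a n - 1) * norm (b n - 1)))" for n
  have norms: "norm (a n) = 1" "norm (b n) = 1" "norm (c n) = 1" for n
    by (simp_all add: a_def b_def c_def del: of_real_mult of_real_divide)
  have lim: "a \<longlonglongrightarrow> 1" "b \<longlonglongrightarrow> 1"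
    unfolding a_def b_def L_def by (rule tendsto_iexp_1)+
  have err: "err \<longlonglongrightarrow> 0"
  proof -
    have "(\<lambda>n. 8 / real n) \<longlonglongrightarrow> 0"
      by (rule real_tendsto_divide_at_top[OF tendsto_const filterlim_real_sequentially])
    then have "err \<longlonglongrightarrow> 0 + (norm (1 * 1 - 1 :: complex) + 4 * (norm (1 - 1 :: complex) * norm (1 - 1 :: complex)))"
      unfolding err_def by (intro tendsto_intros lim)
    then show ?thesis by simp
  qed
  have main: "(\<lambda>n. ewens_prod (a n + b n - 2) (2 * n) * c n) \<longlonglongrightarrow> of_real (exp (- s\<^sup>2 / 2) * exp (- t\<^sup>2 / 2))"
    using ewens_prod_clt[of s t] by (simp add: a_def b_def c_def L_def add.commute)
  define I where "I n = (LINT m|measure_pmf (uniform_map n).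
      iexp (s * ((real (card (vertices n m)) - L n) / sqrt (L n)) +
            t * ((real (card (faces n m)) - L n) / sqrt (L n))))" for n
  have "(\<lambda>n. I n - ewens_prod (a n + b n - 2) (2 * n) * c n) \<longlonglongrightarrow> 0"
  proof (rule Lim_null_comparison[OF _ err])
    show "\<forall>\<^sub>F n in sequentially. norm (I n - ewens_prod (a n + b n - 2) (2 * n) * c n) \<le> err n"
      using eventually_ge_at_top[of 2]
    proof eventually_elim
      case (elim n)
      have L: "L n > 0" using elim by (simp add: L_def)
      have split: "iexp (s * ((real v - L n) / sqrt (L n)) + t * ((real w - L n) / sqrt (L n))) =
          a n ^ w * b n ^ v * c n" for v w
      proof -
        have "s * ((real v - L n) / sqrt (L n)) + t * ((real w - L n) / sqrt (L n)) =
            real w * (t / sqrt (L n)) + real v * (s / sqrt (L n)) - (s + t) * (L n / sqrt (L n))"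
          by (simp add: diff_divide_distrib add_divide_distrib algebra_simps)
        also have "L n / sqrt (L n) = sqrt (L n)" using L by (simp add: real_div_sqrt)
        moreover have "iexp (real w * p + real v * q - r) = iexp p ^ w * iexp q ^ v * iexp (- r)" for p q r
          by (simp add: exp_of_nat_mult[symmetric] exp_add[symmetric] algebra_simps)
        ultimately show ?thesis unfolding a_def b_def c_def by (simp only:)
      qed
      define avg where "avg = (\<Sum>m\<in>labeled_maps n. f n m) / card (labeled_maps n)"
      define avg' where "avg' = (\<Sum>m\<in>gluings n. f n m) / card (gluings n)"
      define \<pi> where "\<pi> = ewens_prod (a n + b n - 2) (2 * n)"
      have I: "I n = avg * c n"
        unfolding I_def split integral_uniform_map avg_def f_def by (simp add: sum_distrib_right)
      have "norm (avg - avg') \<le> 2 * (4 / real n)"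
        unfolding avg_def avg'_def
        by (rule norm_average_diff_le[OF finite_gluings labeled_maps_subset_gluings labeled_maps_nonempty])
          (use card_gluings_diff_labeled_maps_le[OF elim] in \<open>simp_all add: f_def norm_mult norm_power norms\<close>)
      moreover have "norm (avg' - \<pi>) \<le> norm (a n * b n - 1) + 4 * (norm (a n - 1) * norm (b n - 1))"
        unfolding avg'_def \<pi>_def f_def using elim by (intro norm_average_gluings_le norms) auto
      moreover have "norm (avg - \<pi>) \<le> norm (avg - avg') + norm (avg' - \<pi>)"
        using norm_triangle_ineq[of "avg - avg'" "avg' - \<pi>"] by simp
      moreover have "norm (I n - \<pi> * c n) = norm (avg - \<pi>)"
        unfolding I left_diff_distrib[symmetric] by (simp add: norm_mult norms)
      ultimately show ?case unfolding err_def \<pi>_def by simp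
    qed
  qed
  from tendsto_add[OF this main] show ?thesis by (simp add: I_def L_def)
qed

lemma char_indep_std_normal:
  assumes P: "prob_space P"
    and N1: "distributed P lborel N1 (\<lambda>x. ennreal (std_normal_density x))"
    and N2: "distributed P lborel N2 (\<lambda>x. ennreal (std_normal_density x))"
    and indep: "prob_space.indep_var P borel N1 borel N2"
  shows "(LINT \<omega>|P. iexp (s * N1 \<omega> + t * N2 \<omega>)) = of_real (exp (- s\<^sup>2 / 2) * exp (- t\<^sup>2 / 2))"
proof -
  interpret prob_space P by (rule P)
  have meas [measurable]: "N1 \<in> borel_measurable P" "N2 \<in> borel_measurable P"
    using indep by (auto dest: indep_var_rv1 indep_var_rv2)
  have char: "(LINT \<omega>|P. iexp (s * Z \<omega>)) = of_real (exp (- s\<^sup>2 / 2))"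
    if Z: "distributed P lborel Z (\<lambda>x. ennreal (std_normal_density x))" "Z \<in> borel_measurable P" for Z s
  proof -
    have "distr P borel Z = distr P lborel Z" by (rule distr_cong) auto
    then have "distr P borel Z = std_normal_distribution"
      using distributed_distr_eq_density[OF Z(1)] by simp
    then have "char (distr P borel Z) s = of_real (exp (- s\<^sup>2 / 2))"
      by (simp add: char_std_normal_distribution)
    then show ?thesis using Z(2) by (simp add: char_def integral_distr)
  qed
  have "(LINT \<omega>|P. iexp (s * N1 \<omega> + t * N2 \<omega>)) = (LINT \<omega>|P. iexp (s * N1 \<omega>) * iexp (t * N2 \<omega>))"
    by (simp add: exp_add distrib_left)
  also have "\<dots> = (LINT \<omega>|P. iexp (s * N1 \<omega>)) * (LINT \<omega>|P. iexp (t * N2 \<omega>))"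
    by (intro indep_var_lebesgue_integral indep_var_compose[unfolded comp_def, OF indep])
      (auto intro!: integrable_iexp)
  finally show ?thesis unfolding char[OF N1 meas(1)] char[OF N2 meas(2)] by simp
qed

theorem proposition7:
  fixes P :: "'a measure" and N1 N2 :: "'a \<Rightarrow> real"
  assumes "prob_space P"
    and "distributed P lborel N1 (\<lambda>x. ennreal (std_normal_density x))"
    and "distributed P lborel N2 (\<lambda>x. ennreal (std_normal_density x))"
    and "prob_space.indep_var P borel N1 borel N2"
  shows "conv_in_distr
    (\<lambda>n. measure_pmf (uniform_map n))
    (\<lambda>n m.
      ((real (card (vertices n m)) - ln (real n)) / sqrt (ln (real n)),
       (real (card (faces n m)) - ln (real n)) / sqrt (ln (real n)),
       (genus n m - real n / 2 + ln (real n)) / sqrt (ln (real n))))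
    P
    (\<lambda>\<omega>. (N1 \<omega>, N2 \<omega>, - (N1 \<omega> + N2 \<omega>) / 2))"
proof -
  define L where "L n = ln (real n)" for n
  define X where "X n m = (real (card (vertices n m)) - L n) / sqrt (L n)" for n m
  define Y where "Y n m = (real (card (faces n m)) - L n) / sqrt (L n)" for n m
  interpret prob_space P by fact
  have N [measurable]: "N1 \<in> borel_measurable P" "N2 \<in> borel_measurable P"
    using assms(4) by (auto dest: indep_var_rv1 indep_var_rv2)
  interpret joint_char_conv "\<lambda>n. measure_pmf (uniform_map n)" X Y P N1 N2
  proof
    show "(\<lambda>n. LINT m|measure_pmf (uniform_map n). iexp (s * X n m + t * Y n m)) \<longlonglongrightarrow>
        (LINT \<omega>|P. iexp (s * N1 \<omega> + t * N2 \<omega>))" for s t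
      unfolding char_indep_std_normal[OF assms] X_def Y_def L_def by (rule char_vertices_faces)
  qed (auto simp: prob_space_measure_pmf prob_space_axioms)
  \<comment> \<open>The 1 in Euler's relation survives as a shift, so the test function of
    \<open>(X, Y)\<close> depends on \<open>n\<close>. For \<open>n \<le> 1\<close> both sides are
    0, division by 0 being 0.\<close>
  have genus: "(genus n m - real n / 2 + L n) / sqrt (L n) = - (X n m + Y n m) / 2 + 1 / sqrt (L n)" for n m
    by (simp add: genus_def X_def Y_def add_divide_distrib[symmetric] diff_divide_distrib[symmetric]
        field_simps)
  show ?thesis
    unfolding conv_in_distr_def weak_conv_borel_def
  proof (intro allI impI, elim conjE)
    fix f :: "real \<times> real \<times> real \<Rightarrow> real"
    assume f: "continuous_on UNIV f" and "bounded (range f)"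
    then obtain B where B: "\<And>z. \<bar>f z\<bar> \<le> B" by (auto simp: bounded_iff)
    define h where "h n z = f (fst z, snd z, - (fst z + snd z) / 2 + 1 / sqrt (L n))" for n z
    define h' where "h' z = f (fst z, snd z, - (fst z + snd z) / 2)" for z
    have [measurable]: "f \<in> borel_measurable borel" using f by (rule borel_measurable_continuous_onI)
    have L0: "(\<lambda>n. 1 / sqrt (L n)) \<longlonglongrightarrow> 0"
      unfolding L_def by (rule real_tendsto_divide_at_top[OF tendsto_const
          filterlim_compose[OF sqrt_at_top ln_real_at_top]])
    have "(\<lambda>n. LINT m|measure_pmf (uniform_map n). h n (X n m, Y n m)) \<longlonglongrightarrow> (LINT \<omega>|P. h' (N1 \<omega>, N2 \<omega>))"
    proof (rule tendsto_integral_uniform_on_compacts)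
      show "continuous_on UNIV (h n)" for n
        unfolding h_def by (intro continuous_on_compose2[OF f] continuous_intros) auto
      show "continuous_on UNIV h'"
        unfolding h'_def by (intro continuous_on_compose2[OF f] continuous_intros) auto
      show "\<bar>h n z\<bar> \<le> B" "\<bar>h' z\<bar> \<le> B" for n z by (simp_all add: h_def h'_def B)
      fix K :: real
      \<comment> \<open>The third coordinate is minus the mean of two numbers in
        \<open>{-K..K}\<close>, up to a shift that is eventually below 1.\<close>
      define C where "C = {-K..K} \<times> {-K..K} \<times> {-K - 1..K + 1}"
      have "uniformly_continuous_on C f"
        unfolding C_def by (intro compact_uniformly_continuous continuous_on_subset[OF f] compact_Times compact_Icc) auto
      show "uniform_limit ({-K..K} \<times> {-K..K}) h h' sequentially"
      proof (rule uniform_limitI)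
        fix e :: real assume "e > 0"
        then obtain d where d: "d > 0" "\<And>z z'. z \<in> C \<Longrightarrow> z' \<in> C \<Longrightarrow> dist z' z < d \<Longrightarrow> dist (f z') (f z) < e"
          using \<open>uniformly_continuous_on C f\<close> unfolding uniformly_continuous_on_def by meson
        have "\<forall>\<^sub>F n in sequentially. dist (1 / sqrt (L n)) 0 < min d 1"
          using d by (intro tendstoD[OF L0]) auto
        then show "\<forall>\<^sub>F n in sequentially. \<forall>z\<in>{-K..K} \<times> {-K..K}. dist (h n z) (h' z) < e"
        proof eventually_elim
          case (elim n)
          define \<delta> where "\<delta> = 1 / sqrt (L n)"
          have \<delta>: "\<bar>\<delta>\<bar> < d" "\<bar>\<delta>\<bar> < 1" using elim by (auto simp: \<delta>_def dist_real_def)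
          show ?case
          proof
            fix z assume z: "z \<in> {-K..K} \<times> {-K..K}"
            show "dist (h n z) (h' z) < e"
              unfolding h_def h'_def \<delta>_def[symmetric]
            proof (rule d(2))
              show "(fst z, snd z, - (fst z + snd z) / 2) \<in> C"
                using z by (auto simp: C_def)
              show "(fst z, snd z, - (fst z + snd z) / 2 + \<delta>) \<in> C"
                using z \<delta>(2) by (auto simp: C_def abs_less_iff field_simps)
              show "dist (fst z, snd z, - (fst z + snd z) / 2 + \<delta>) (fst z, snd z, - (fst z + snd z) / 2) < d"
                using \<delta>(1) by (simp add: dist_Pair_Pair dist_real_def)
            qed
          qed
        qed
      qed
    qed
    then show "(\<lambda>n. integral\<^sup>L (distr (measure_pmf (uniform_map n)) borel (\<lambda>m.
        ((real (card (vertices n m)) - ln (real n)) / sqrt (ln (real n)),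
         (real (card (faces n m)) - ln (real n)) / sqrt (ln (real n)),
         (genus n m - real n / 2 + ln (real n)) / sqrt (ln (real n))))) f)
      \<longlonglongrightarrow> integral\<^sup>L (distr P borel (\<lambda>\<omega>. (N1 \<omega>, N2 \<omega>, - (N1 \<omega> + N2 \<omega>) / 2))) f"
      unfolding L_def[symmetric] X_def[symmetric] Y_def[symmetric] genus
      by (simp add: integral_distr h_def h'_def)
  qed
qed

end
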